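(* Let $w_1,\dots,w_N$ be classical scalar weights in the same Darboux equivalence class, and let $\delta_j$ denote the second-order differential operator associated with $w_j$. Then the center of the algebra $\mathcal D(w_1\oplus\cdots\oplus w_N)$ is the polynomial algebra generated by the diagonal differential operator $\Delta=\operatorname{diag}(\delta_1,\dots,\delta_N)$. Explicitly, $$\mathcal Z(w_1\oplus\cdots\oplus w_N)=\{p(\Delta):p\in\mathbb C[x]\}=\{\operatorname{diag}(p(\delta_1),\dots,p(\delta_N)):p\in\mathbb C[x]\}.$$
   Context: For a weight matrix $W$ of size $N$ (smooth, positive definite a.e. on an interval, finite moments), $\{P_n\}$ denotes the monic matrix polynomials orthogonal for $\langle P,Q\rangle_W=\int P(x)W(x)Q(x)^*dx$. Differential operators $D=\sum_{j}\partial^jF_j(x)$ with polynomial (matrix) coefficients, forming the algebra $\operatorname{Mat}_N(\Omega[x])$, act on the right: $P\cdot D=\sum_j\partial^j(P)F_j$, and $P\cdot(D_1D_2)=(P\cdot D_1)\cdot D_2$. $\mathcal D(W)=\{D\in\operatorname{Mat}_N(\Omega[x]):\text{for all }n\ge0,\ P_n\cdot D=\Lambda_n(D)P_n\text{ for some }\Lambda_n(D)\in\operatorname{Mat}_N(\mathbb C)\}$, and $\mathcal Z(W)$ is its center. Classical scalar weights and their second-order operators: shifted Hermite $w_b(x)=e^{-x^2+2bx}$ on $(-\infty,\infty)$, $\delta=\partial^2-2\partial(x-b)$; Laguerre $w_\alpha(x)=e^{-x}x^\alpha$ on $(0,\infty)$, $\alpha>-1$, $\delta=\partial^2x+\partial(\alpha+1-x)$;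 Jacobi $w_{\alpha,\beta}(x)=(1-x)^\alpha(1+x)^\beta$ on $(-1,1)$, $\alpha,\beta>-1$, $\delta=\partial^2(1-x^2)+\partial(\beta-\alpha-x(\alpha+\beta+2))$. Darboux equivalence: an operator is degree-preserving if $\deg(P\cdot\mathcal V)=\deg P$ for all polynomials $P$; $\tilde w$ is a Darboux transformation of $w$ (same support, monic orthogonal polynomials $\tilde p_n$, $p_n$) if some $D\in\mathcal D(w)$ factors as $D=\mathcal V\mathcal N$ with $\mathcal V,\mathcal N$ degree-preserving operators with polynomial coefficients and $p_n\cdot\mathcal V=a_n\tilde p_n$, $a_n\in\mathbb C$, for all $n\ge0$. This is an equivalence relation. For classical weights: $w_a,w_b$ shifted Hermite are equivalent iff $a=b$; Laguerre $w_\alpha,w_{\tilde\alpha}$ iff $\alpha-\tilde\alpha\in\mathbb Z$; Jacobi $w_{\alpha,\beta},w_{\tilde\alpha,\tilde\beta}$ iff $\alpha+\beta=\tilde\alpha+\tilde\beta$ and $\alpha-\tilde\alpha\in\mathbb Z$. *)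

theory Defs
  imports "HOL-Analysis.Analysis" "HOL-Computational_Algebra.Polynomial"
begin

text \<open>
  A differential operator with polynomial coefficients is represented by the linear map
  \<open>P \<mapsto> P \<cdot> D\<close> that it induces on polynomials. This loses nothing: in characteristic zero
  the coefficients \<open>F\<^sub>j\<close> of \<open>D = \<Sum>\<^sub>j \<partial>\<^sup>j F\<^sub>j(x)\<close> are recovered from the action on \<open>x\<^sup>k I\<close>.
\<close>

definition scalar_ops :: "(complex poly \<Rightarrow> complex poly) set" where
  "scalar_ops = {D. \<exists>(m::nat) f. D = (\<lambda>p. \<Sum>j\<le>m. (pderiv ^^ j) p * f j)}"

text \<open>Operators act on the right, \<open>P \<cdot> (D\<^sub>1 D\<^sub>2) = (P \<cdot> D\<^sub>1) \<cdot> D\<^sub>2\<close>, so the product is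
  composition in reverse order.\<close>

definition op_mult :: "('a \<Rightarrow> 'a) \<Rightarrow> ('a \<Rightarrow> 'a) \<Rightarrow> 'a \<Rightarrow> 'a" where
  "op_mult D1 D2 = (\<lambda>P. D2 (D1 P))"

definition scalar_op_poly ::
  "complex poly \<Rightarrow> (complex poly \<Rightarrow> complex poly) \<Rightarrow> complex poly \<Rightarrow> complex poly" where
  "scalar_op_poly p D = (\<lambda>q. \<Sum>k\<le>degree p. smult (coeff p k) ((D ^^ k) q))"

text \<open>Weights are functions on the whole real line that vanish off their interval.\<close>

definition weight_support :: "(real \<Rightarrow> real) \<Rightarrow> real set" where
  "weight_support w = closure {x. w x \<noteq> 0}"

definition scalar_inner :: "(real \<Rightarrow> real) \<Rightarrow> complex poly \<Rightarrow> complex poly \<Rightarrow> complex" where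
  "scalar_inner w p q =
     (LINT x|lborel. poly p (of_real x) * of_real (w x) * cnj (poly q (of_real x)))"

definition scalar_monic_ops :: "(real \<Rightarrow> real) \<Rightarrow> nat \<Rightarrow> complex poly" where
  "scalar_monic_ops w = (THE p.
     (\<forall>n. degree (p n) = n \<and> lead_coeff (p n) = 1) \<and>
     (\<forall>m n. m \<noteq> n \<longrightarrow> scalar_inner w (p m) (p n) = 0))"

definition scalar_D :: "(real \<Rightarrow> real) \<Rightarrow> (complex poly \<Rightarrow> complex poly) set" where
  "scalar_D w = {D \<in> scalar_ops.
     \<forall>n. \<exists>c. D (scalar_monic_ops w n) = smult c (scalar_monic_ops w n)}"

text \<open>The zero polynomial must be excluded by hand: the library sets \<open>degree 0 = 0\<close>, which would
  let an operator that kills the constants pass as degree-preserving.\<close>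

definition degree_preserving :: "(complex poly \<Rightarrow> complex poly) \<Rightarrow> bool" where
  "degree_preserving V \<longleftrightarrow> (\<forall>p. p \<noteq> 0 \<longrightarrow> V p \<noteq> 0 \<and> degree (V p) = degree p)"

text \<open>\<open>darboux w w'\<close>: the weight \<open>w'\<close> is a Darboux transformation of \<open>w\<close>.\<close>

definition darboux :: "(real \<Rightarrow> real) \<Rightarrow> (real \<Rightarrow> real) \<Rightarrow> bool" where
  "darboux w w' \<longleftrightarrow>
     weight_support w = weight_support w' \<and>
     (\<exists>D \<in> scalar_D w. \<exists>V \<in> scalar_ops. \<exists>N \<in> scalar_ops.
        degree_preserving V \<and> degree_preserving N \<and> D = op_mult V N \<and>
        (\<exists>a :: nat \<Rightarrow> complex.
           \<forall>n. V (scalar_monic_ops w n) = smult (a n) (scalar_monic_ops w' n)))"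

definition hermite_weight :: "real \<Rightarrow> real \<Rightarrow> real" where
  "hermite_weight b x = exp (- (x ^ 2) + 2 * b * x)"

definition laguerre_weight :: "real \<Rightarrow> real \<Rightarrow> real" where
  "laguerre_weight \<alpha> x = (if 0 < x then exp (- x) * x powr \<alpha> else 0)"

definition jacobi_weight :: "real \<Rightarrow> real \<Rightarrow> real \<Rightarrow> real" where
  "jacobi_weight \<alpha> \<beta> x =
     (if - 1 < x \<and> x < 1 then (1 - x) powr \<alpha> * (1 + x) powr \<beta> else 0)"

definition hermite_op :: "real \<Rightarrow> complex poly \<Rightarrow> complex poly" where
  "hermite_op b p = (pderiv ^^ 2) p - 2 * pderiv p * [:- of_real b, 1:]"

definition laguerre_op :: "real \<Rightarrow> complex poly \<Rightarrow> complex poly" where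
  "laguerre_op \<alpha> p = (pderiv ^^ 2) p * [:0, 1:] + pderiv p * [:of_real (\<alpha> + 1), - 1:]"

definition jacobi_op :: "real \<Rightarrow> real \<Rightarrow> complex poly \<Rightarrow> complex poly" where
  "jacobi_op \<alpha> \<beta> p =
     (pderiv ^^ 2) p * [:1, 0, - 1:] + pderiv p * [:of_real (\<beta> - \<alpha>), - of_real (\<alpha> + \<beta> + 2):]"

text \<open>\<open>classical w \<delta>\<close>: \<open>w\<close> is a classical weight and \<open>\<delta>\<close> is its second-order operator.\<close>

inductive classical ::
  "(real \<Rightarrow> real) \<Rightarrow> (complex poly \<Rightarrow> complex poly) \<Rightarrow> bool" where
  hermite: "classical (hermite_weight b) (hermite_op b)"
| laguerre: "\<alpha> > - 1 \<Longrightarrow> classical (laguerre_weight \<alpha>) (laguerre_op \<alpha>)"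
| jacobi: "\<alpha> > - 1 \<Longrightarrow> \<beta> > - 1 \<Longrightarrow> classical (jacobi_weight \<alpha> \<beta>) (jacobi_op \<alpha> \<beta>)"

type_synonym 'n matpoly = "complex poly ^ 'n ^ 'n"
type_synonym 'n mat_op = "'n matpoly \<Rightarrow> 'n matpoly"

definition mderiv :: "'n::finite mat_op" where
  "mderiv P = (\<chi> i j. pderiv (P $ i $ j))"

definition msmult :: "complex \<Rightarrow> 'n::finite mat_op" where
  "msmult c P = (\<chi> i j. smult c (P $ i $ j))"

definition meval :: "'n::finite matpoly \<Rightarrow> real \<Rightarrow> complex ^ 'n ^ 'n" where
  "meval P x = (\<chi> i j. poly (P $ i $ j) (of_real x))"

definition mconst :: "complex ^ 'n ^ 'n \<Rightarrow> 'n::finite matpoly" where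
  "mconst A = (\<chi> i j. [:A $ i $ j:])"

definition adjoint_mat :: "complex ^ 'n ^ 'n \<Rightarrow> complex ^ 'n ^ ('n::finite)" where
  "adjoint_mat A = (\<chi> i j. cnj (A $ j $ i))"

definition mat_ops :: "'n::finite mat_op set" where
  "mat_ops = {D. \<exists>(m::nat) F. D = (\<lambda>P. \<Sum>j\<le>m. (mderiv ^^ j) P ** F j)}"

definition mat_op_poly :: "complex poly \<Rightarrow> 'n::finite mat_op \<Rightarrow> 'n mat_op" where
  "mat_op_poly p D = (\<lambda>P. \<Sum>k\<le>degree p. msmult (coeff p k) ((D ^^ k) P))"

text \<open>If \<open>D j = \<Sum>\<^sub>k \<partial>\<^sup>k f\<^sub>j\<^sub>k\<close>, this is \<open>\<Sum>\<^sub>k \<partial>\<^sup>k F\<^sub>k\<close> with \<open>F\<^sub>k\<close> the diagonal matrix with entries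
  \<open>f\<^sub>j\<^sub>k\<close>; multiplying by \<open>F\<^sub>k\<close> on the right acts on columns.\<close>

definition diag_op :: "('n::finite \<Rightarrow> complex poly \<Rightarrow> complex poly) \<Rightarrow> 'n mat_op" where
  "diag_op D P = (\<chi> i j. D j (P $ i $ j))"

definition mat_inner ::
  "(real \<Rightarrow> complex ^ 'n ^ 'n) \<Rightarrow> 'n matpoly \<Rightarrow> 'n::finite matpoly \<Rightarrow> complex ^ 'n ^ 'n" where
  "mat_inner W P Q = (LINT x|lborel. meval P x ** W x ** adjoint_mat (meval Q x))"

definition mat_monic :: "nat \<Rightarrow> 'n::finite matpoly \<Rightarrow> bool" where
  "mat_monic n P \<longleftrightarrow>
     (\<chi> i j. coeff (P $ i $ j) n) = (mat 1 :: complex ^ 'n ^ 'n) \<and>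
     (\<forall>i j. degree (P $ i $ j) \<le> n)"

definition mat_monic_ops :: "(real \<Rightarrow> complex ^ 'n ^ 'n) \<Rightarrow> nat \<Rightarrow> 'n::finite matpoly" where
  "mat_monic_ops W = (THE P.
     (\<forall>n. mat_monic n (P n)) \<and> (\<forall>m n. m \<noteq> n \<longrightarrow> mat_inner W (P m) (P n) = 0))"

definition mat_D :: "(real \<Rightarrow> complex ^ 'n ^ 'n) \<Rightarrow> 'n::finite mat_op set" where
  "mat_D W = {D \<in> mat_ops. \<forall>n. \<exists>\<Lambda>. D (mat_monic_ops W n) = mconst \<Lambda> ** mat_monic_ops W n}"

definition mat_Z :: "(real \<Rightarrow> complex ^ 'n ^ 'n) \<Rightarrow> 'n::finite mat_op set" where
  "mat_Z W = {D \<in> mat_D W. \<forall>E \<in> mat_D W. op_mult D E = op_mult E D}"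

definition direct_sum :: "('n::finite \<Rightarrow> real \<Rightarrow> real) \<Rightarrow> real \<Rightarrow> complex ^ 'n ^ 'n" where
  "direct_sum w x = (\<chi> i j. if i = j then of_real (w i x) else 0)"

end

theory Submission
  imports Defs "HOL-Probability.Distributions" "HOL-Real_Asymp.Real_Asymp"
begin

text \<open>
  Write \<open>p\<^sub>n\<^sup>(\<^sup>i\<^sup>)\<close> for the monic orthogonal polynomials of \<open>w\<^sub>i\<close>. Those of the direct sum are the
  diagonal matrices with entries \<open>p\<^sub>n\<^sup>(\<^sup>i\<^sup>)\<close>, so a matrix operator with entries \<open>d\<^sub>i\<^sub>j\<close> belongs to the
  algebra iff every \<open>d\<^sub>i\<^sub>j\<close> sends \<open>p\<^sub>n\<^sup>(\<^sup>i\<^sup>)\<close> to a multiple of \<open>p\<^sub>n\<^sup>(\<^sup>j\<^sup>)\<close>. Since \<open>(p\<^sub>n\<^sup>(\<^sup>i\<^sup>))\<close> is a basis of the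
  polynomials, such a \<open>d\<^sub>i\<^sub>j\<close> is determined by the sequence of these multiples, and products of
  operators become products of sequences.

  A central operator commutes with the diagonal idempotents, hence is diagonal; it commutes with
  the Darboux intertwiners placed in the \<open>(i, j)\<close> entry, whose multiples never vanish, hence all
  its diagonal entries have one and the same eigenvalue sequence \<open>\<lambda>\<^sub>n\<close>. Conversely, if all \<open>\<delta>\<^sub>j\<close> share
  their eigenvalue sequence \<open>\<mu>\<^sub>n\<close>, then \<open>p(\<Delta>)\<close> commutes with the whole algebra. This argument is
  \<open>center_of_intertwined_family\<close>, and it leaves two facts to prove about the classical weights.

  The first is that \<open>\<lambda>\<^sub>n\<close> is a polynomial in \<open>\<mu>\<^sub>n\<close>
  (\<open>eigenvalue_is_polynomial_in_classical_eigenvalue\<close>). Comparing coefficients of \<open>x\<^sup>n\<close> shows that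
  \<open>\<lambda>\<^sub>n\<close> is a polynomial in \<open>n\<close>, which suffices for Hermite and Laguerre, where \<open>\<mu>\<^sub>n\<close> is linear in
  \<open>n\<close>. For Jacobi, \<open>\<mu>\<^sub>n = - n (n + s)\<close> with \<open>s = \<alpha> + \<beta> + 1\<close>, and one has to exclude a part of \<open>\<lambda>\<^sub>n\<close> that
  is odd under \<open>n \<mapsto> - s - n\<close>. An operator \<open>E\<close> with odd eigenvalues \<open>(2 n + s) b(\<mu>\<^sub>n)\<close> would satisfy
  \<open>E\<^sup>2 = c(\<delta>)\<close> with \<open>c\<close> of odd degree \<open>d\<close>, and comparing leading coefficients would make
  \<open>(1 - x\<^sup>2)\<^sup>d\<close> a square up to a constant, which its odd order of vanishing at \<open>1\<close> forbids
  (\<open>eigenvalue_polynomial_of_quadratic\<close>).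

  The second is that Darboux equivalent weights have equal \<open>\<mu>\<^sub>n\<close> (\<open>darboux_eigenvalue_eq\<close>). The
  support determines the family, and only Jacobi has eigenvalues that depend on its parameters. If
  \<open>D = V N\<close> realises the transformation, then both \<open>D\<close> and \<open>V \<delta>' N\<close> lie in the algebra of the
  first weight, with eigenvalues \<open>\<lambda>\<^sub>n\<close> and \<open>\<lambda>\<^sub>n \<mu>'\<^sub>n\<close>. By the first fact both are invariant under
  \<open>n \<mapsto> - s - n\<close>, hence so is \<open>\<mu>'\<^sub>n = - n (n + s')\<close>, which forces \<open>s = s'\<close>.

  The analytic input is that the eigenpolynomials of \<open>\<delta>\<close> are the orthogonal polynomials. It follows
  from the Pearson equation \<open>(\<sigma> w)' = \<tau> w\<close>: integration by parts makes \<open>\<delta> = \<partial>\<^sup>2 \<sigma> + \<partial> \<tau>\<close> symmetric, and its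
  eigenvalues are distinct.
\<close>

section \<open>Linear maps on polynomials and monic bases\<close>

abbreviation poly_linear :: "(complex poly \<Rightarrow> complex poly) \<Rightarrow> bool" where
  "poly_linear D \<equiv> module_hom smult smult D"

lemma poly_linearI:
  assumes "\<And>p q. D (p + q) = D p + D q" and "\<And>c p. D (smult c p) = smult c (D p)"
  shows "poly_linear D"
  using assms by unfold_locales (auto simp: smult_add_right smult_add_left)

lemma smult_cancel_poly: "q \<noteq> 0 \<Longrightarrow> smult a q = smult b q \<longleftrightarrow> a = (b :: complex)"
  using smult_eq_0_iff[of "a - b" q] by (simp add: smult_diff_left)

lemma smult_sum_right: "smult c (\<Sum>i\<in>A. f i) = (\<Sum>i\<in>A. smult c (f i))"
  by (induction A rule: infinite_finite_induct) (simp_all add: smult_add_right)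

locale monic_basis =
  fixes p :: "nat \<Rightarrow> complex poly"
  assumes degree_p [simp]: "degree (p n) = n"
    and lead_coeff_p [simp]: "coeff (p n) n = 1"
begin

lemma p_nonzero [simp]: "p n \<noteq> 0"
  using lead_coeff_p[of n] by (metis coeff_0 zero_neq_one)

text \<open>The degree bound is expressed by vanishing coefficients, so that for \<open>n = 0\<close> it means \<open>q = 0\<close>;
  a bound on \<open>degree q\<close> could not single out the zero polynomial.\<close>
lemma expand:
  assumes "\<And>k. n \<le> k \<Longrightarrow> coeff q k = 0"
  shows "\<exists>c. q = (\<Sum>k<n. smult (c k) (p k))"
  using assms
proof (induction n arbitrary: q)
  case 0
  then show ?case by (auto intro: poly_eqI)
next
  case (Suc n)
  have "\<exists>c. q - smult (coeff q n) (p n) = (\<Sum>k<n. smult (c k) (p k))"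
  proof (rule Suc.IH)
    fix k assume "n \<le> k"
    then show "coeff (q - smult (coeff q n) (p n)) k = 0"
      using Suc.prems[of k] by (cases "k = n") (auto simp: coeff_eq_0)
  qed
  then obtain c where c: "q - smult (coeff q n) (p n) = (\<Sum>k<n. smult (c k) (p k))" ..
  have "(\<Sum>k<n. smult ((c(n := coeff q n)) k) (p k)) = (\<Sum>k<n. smult (c k) (p k))"
    by (rule sum.cong) auto
  with c have "q = (\<Sum>k<Suc n. smult ((c(n := coeff q n)) k) (p k))"
    by (simp add: algebra_simps)
  then show ?case by blast
qed

lemma linear_eqI:
  assumes D: "poly_linear D" and E: "poly_linear E" and eq: "\<And>n. D (p n) = E (p n)"
  shows "D = E"
proof
  fix q
  obtain c where q: "q = (\<Sum>k<Suc (degree q). smult (c k) (p k))"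
    using expand[of "Suc (degree q)" q] by (auto simp: coeff_eq_0)
  show "D q = E q"
    by (subst (1 2) q) (simp only: module_hom.sum[OF D] module_hom.sum[OF E]
        module_hom.scale[OF D] module_hom.scale[OF E] eq)
qed

text \<open>The eigenvalues can be read off without knowing the eigenpolynomials: \<open>x\<^sup>n\<close> differs from \<open>p n\<close>
  by a combination of the lower \<open>p k\<close>, which \<open>D\<close> maps to polynomials of degree less than \<open>n\<close>.\<close>
lemma coeff_eigenvalue:
  assumes D: "poly_linear D" and eig: "\<And>n. D (p n) = smult (l n) (p n)"
  shows "coeff (D (monom 1 n)) n = l n"
proof -
  obtain c where c: "monom 1 n - p n = (\<Sum>k<n. smult (c k) (p k))"
    using expand[of n "monom 1 n - p n"] by (metis (no_types, lifting) coeff_diff coeff_eq_0 coeff_monom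
        degree_p diff_self lead_coeff_p le_neq_implies_less diff_0 neg_0_equal_iff_equal)
  have "D (monom 1 n) = smult (l n) (p n) + D (monom 1 n - p n)"
    by (simp add: module_hom.diff[OF D] eig)
  also have "D (monom 1 n - p n) = (\<Sum>k<n. smult (c k * l k) (p k))"
    unfolding c by (simp add: module_hom.sum[OF D] module_hom.scale[OF D] eig)
  finally show ?thesis
    by (simp add: coeff_sum coeff_eq_0)
qed

end

section \<open>The algebra of scalar differential operators\<close>
lemma scalar_ops_linear:
  assumes "D \<in> scalar_ops"
  shows "poly_linear D"
proof -
  obtain m f where D: "D = (\<lambda>p. \<Sum>j\<le>m. (pderiv ^^ j) p * f j)"
    using assms by (auto simp: scalar_ops_def)
  show ?thesis
    by (rule poly_linearI) (simp_all add: D higher_pderiv_add higher_pderiv_smult sum.distrib algebra_simps smult_sum_right)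
qed

lemma scalar_opsI:
  "D = (\<lambda>p. \<Sum>j\<le>m. (pderiv ^^ j) p * f j) \<Longrightarrow> D \<in> scalar_ops"
  unfolding scalar_ops_def by blast

lemma scalar_ops_monomial: "(\<lambda>p. (pderiv ^^ k) p * g) \<in> scalar_ops"
proof -
  have "(\<lambda>p. (pderiv ^^ k) p * g) = (\<lambda>p. \<Sum>j\<le>k. (pderiv ^^ j) p * (if j = k then g else 0))"
    by (simp add: if_distrib cong: if_cong)
  then show ?thesis
    by (rule scalar_opsI)
qed

text \<open>Padding the coefficients with zeros gives one coefficient sequence that is valid for every
  sufficiently large order; this lets several operators be written with a common order.\<close>
lemma scalar_ops_extend:
  assumes "D \<in> scalar_ops"
  obtains m f where "\<And>M. m \<le> M \<Longrightarrow> D = (\<lambda>p. \<Sum>j\<le>M. (pderiv ^^ j) p * f j)"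
proof -
  obtain m f where D: "D = (\<lambda>p. \<Sum>j\<le>m. (pderiv ^^ j) p * f j)"
    using assms by (auto simp: scalar_ops_def)
  show ?thesis
  proof (rule that[of m "\<lambda>j. if j \<le> m then f j else 0"])
    fix M assume "m \<le> M"
    then show "D = (\<lambda>p. \<Sum>j\<le>M. (pderiv ^^ j) p * (if j \<le> m then f j else 0))"
      unfolding D by (intro ext sum.mono_neutral_cong_left) auto
  qed
qed

lemma scalar_ops_add:
  assumes "D \<in> scalar_ops" "E \<in> scalar_ops"
  shows "(\<lambda>p. D p + E p) \<in> scalar_ops"
proof -
  obtain m f where D: "\<And>M. m \<le> M \<Longrightarrow> D = (\<lambda>p. \<Sum>j\<le>M. (pderiv ^^ j) p * f j)"
    using scalar_ops_extend[OF assms(1)] by blast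
  obtain n g where E: "\<And>M. n \<le> M \<Longrightarrow> E = (\<lambda>p. \<Sum>j\<le>M. (pderiv ^^ j) p * g j)"
    using scalar_ops_extend[OF assms(2)] by blast
  have "(\<lambda>p. D p + E p) = (\<lambda>p. \<Sum>j\<le>max m n. (pderiv ^^ j) p * (f j + g j))"
    by (simp add: D[of "max m n"] E[of "max m n"] sum.distrib algebra_simps)
  then show ?thesis
    by (rule scalar_opsI)
qed

lemma scalar_ops_0: "(\<lambda>p. 0) \<in> scalar_ops"
  using scalar_ops_monomial[of 0 0] by simp

lemma scalar_ops_id: "(\<lambda>p. p) \<in> scalar_ops"
  using scalar_ops_monomial[of 0 1] by simp

lemma scalar_ops_sum:
  assumes "finite A" "\<And>i. i \<in> A \<Longrightarrow> D i \<in> scalar_ops"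
  shows "(\<lambda>p. \<Sum>i\<in>A. D i p) \<in> scalar_ops"
  using assms by (induction A) (auto intro: scalar_ops_add scalar_ops_0)

lemma scalar_ops_mult:
  assumes "D \<in> scalar_ops"
  shows "(\<lambda>p. D p * g) \<in> scalar_ops"
proof -
  obtain m f where "D = (\<lambda>p. \<Sum>j\<le>m. (pderiv ^^ j) p * f j)"
    using assms by (auto simp: scalar_ops_def)
  then have "(\<lambda>p. D p * g) = (\<lambda>p. \<Sum>j\<le>m. (pderiv ^^ j) p * (f j * g))"
    by (simp add: sum_distrib_right mult.assoc)
  then show ?thesis
    by (rule scalar_opsI)
qed

lemma scalar_ops_smult: "D \<in> scalar_ops \<Longrightarrow> (\<lambda>p. smult c (D p)) \<in> scalar_ops"
  using scalar_ops_mult[of D "[:c:]"] by simp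

text \<open>The Leibniz rule \<open>\<partial>(\<partial>\<^sup>j(p) f) = \<partial>\<^sup>j(p) f' + \<partial>\<^sup>j\<^sup>+\<^sup>1(p) f\<close> moves derivatives past coefficients; this is
  what makes differential operators closed under composition.\<close>
lemma scalar_ops_pderiv_pow:
  assumes "D \<in> scalar_ops"
  shows "(\<lambda>p. (pderiv ^^ k) (D p)) \<in> scalar_ops"
proof (induction k)
  case 0
  show ?case using assms by simp
next
  case (Suc k)
  then obtain m f where D: "(\<lambda>p. (pderiv ^^ k) (D p)) = (\<lambda>p. \<Sum>j\<le>m. (pderiv ^^ j) p * f j)"
    by (auto simp: scalar_ops_def)
  have "(\<lambda>p. (pderiv ^^ Suc k) (D p))
      = (\<lambda>p. \<Sum>j\<le>m. (pderiv ^^ j) p * pderiv (f j) + (pderiv ^^ Suc j) p * f j)"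
    using fun_cong[OF D] by (simp add: higher_pderiv_sum[of 1, simplified] pderiv_mult algebra_simps)
  then show ?case
    by (simp only:) (intro scalar_ops_sum scalar_ops_add scalar_ops_monomial finite_atMost)
qed

lemma scalar_ops_comp:
  assumes D: "D \<in> scalar_ops" and E: "E \<in> scalar_ops"
  shows "(\<lambda>p. E (D p)) \<in> scalar_ops"
proof -
  obtain m f where "E = (\<lambda>p. \<Sum>j\<le>m. (pderiv ^^ j) p * f j)"
    using E by (auto simp: scalar_ops_def)
  then show ?thesis
    by (simp only:) (intro scalar_ops_sum scalar_ops_mult scalar_ops_pderiv_pow D finite_atMost)
qed

lemma scalar_ops_op_poly:
  assumes "D \<in> scalar_ops"
  shows "scalar_op_poly c D \<in> scalar_ops"
proof -
  have "(\<lambda>p. (D ^^ k) p) \<in> scalar_ops" for k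
    by (induction k) (auto intro: scalar_ops_id scalar_ops_comp assms)
  then show ?thesis
    unfolding scalar_op_poly_def by (intro scalar_ops_sum scalar_ops_smult) auto
qed

lemma scalar_op_poly_eigen:
  assumes D: "poly_linear D" and eig: "D q = smult l q"
  shows "scalar_op_poly c D q = smult (poly c l) q"
proof -
  have "(D ^^ k) q = smult (l ^ k) q" for k
    by (induction k) (simp_all add: module_hom.scale[OF D] eig mult.commute)
  then show ?thesis
    by (simp add: scalar_op_poly_def poly_altdef smult_sum mult.commute)
qed

section \<open>Leading coefficients of differential operators\<close>

text \<open>
  For \<open>D = \<Sum>\<^sub>j\<^sub>\<le>\<^sub>m \<partial>\<^sup>j f\<^sub>j\<close> this holds with \<open>s = f\<^sub>m\<close>: applied to a multiple of \<open>(x - t)\<^sup>m\<^sup>+\<^sup>k\<close>, only the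
  term of order \<open>m\<close> survives at lowest order in \<open>x - t\<close>. Describing the leading coefficient by this
  action rather than by a choice of coefficients makes it visibly multiplicative under
  composition. The value \<open>s = 0\<close> is allowed and means that the order is less than \<open>m\<close>.
\<close>
definition has_symbol :: "(complex poly \<Rightarrow> complex poly) \<Rightarrow> nat \<Rightarrow> complex poly \<Rightarrow> bool" where
  "has_symbol D m s \<longleftrightarrow> (\<forall>t k q. \<exists>r. D ([:- t, 1:] ^ (m + k) * q) = [:- t, 1:] ^ k * r \<and>
     poly r t = fact (m + k) / fact k * poly s t * poly q t)"

lemma has_symbolI:
  assumes "\<And>t k q. \<exists>r. D ([:- t, 1:] ^ (m + k) * q) = [:- t, 1:] ^ k * r \<and>
     poly r t = fact (m + k) / fact k * poly s t * poly q t"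
  shows "has_symbol D m s"
  using assms by (auto simp: has_symbol_def)

lemma has_symbolE:
  assumes "has_symbol D m s"
  obtains r where "D ([:- t, 1:] ^ (m + k) * q) = [:- t, 1:] ^ k * r"
    and "poly r t = fact (m + k) / fact k * poly s t * poly q t"
  using assms unfolding has_symbol_def by blast

lemma has_symbol_unique:
  assumes "has_symbol D m s" "has_symbol D m s'"
  shows "s = s'"
proof -
  have "poly s t = poly s' t" for t
  proof -
    obtain r where "D ([:- t, 1:] ^ (m + 0) * 1) = [:- t, 1:] ^ 0 * r"
      and "poly r t = fact (m + 0) / fact 0 * poly s t * poly 1 t"
      using assms(1) by (rule has_symbolE)
    moreover obtain r' where "D ([:- t, 1:] ^ (m + 0) * 1) = [:- t, 1:] ^ 0 * r'"
      and "poly r' t = fact (m + 0) / fact 0 * poly s' t * poly 1 t"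
      using assms(2) by (rule has_symbolE)
    ultimately show ?thesis by simp
  qed
  then show ?thesis
    by (intro poly_eq_poly_eq_iff[THEN iffD1] ext)
qed

lemma has_symbol_raise:
  assumes D: "has_symbol D m s" and "m < m'"
  shows "has_symbol D m' 0"
proof (rule has_symbolI)
  fix t k q
  have m': "m' + k = m + (m' - m + k)"
    using \<open>m < m'\<close> by simp
  obtain r where "D ([:- t, 1:] ^ (m + (m' - m + k)) * q) = [:- t, 1:] ^ (m' - m + k) * r"
    using D by (rule has_symbolE)
  then have "D ([:- t, 1:] ^ (m' + k) * q) = [:- t, 1:] ^ k * ([:- t, 1:] ^ (m' - m) * r)"
    unfolding m' by (simp add: power_add mult_ac)
  with \<open>m < m'\<close> show "\<exists>r. D ([:- t, 1:] ^ (m' + k) * q) = [:- t, 1:] ^ k * r \<and>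
     poly r t = fact (m' + k) / fact k * poly 0 t * poly q t"
    by (intro exI[of _ "[:- t, 1:] ^ (m' - m) * r"]) (simp add: poly_power)
qed

lemma has_symbol_order_unique:
  assumes D: "has_symbol D m s" "s \<noteq> 0" and D': "has_symbol D m' s'" "s' \<noteq> 0"
  shows "m = m'"
proof (rule ccontr)
  assume "m \<noteq> m'"
  then consider "m < m'" | "m' < m"
    by linarith
  then show False
  proof cases
    case 1
    from has_symbol_unique[OF has_symbol_raise[OF D(1) this] D'(1)] D'(2) show False by simp
  next
    case 2
    from has_symbol_unique[OF has_symbol_raise[OF D'(1) this] D(1)] D(2) show False by simp
  qed
qed

lemma has_symbol_0: "has_symbol (\<lambda>p. 0) m 0"
  by (rule has_symbolI) (auto intro: exI[of _ 0])

lemma has_symbol_add: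
  assumes D: "has_symbol D m s" and E: "has_symbol E m s'"
  shows "has_symbol (\<lambda>p. D p + E p) m (s + s')"
proof (rule has_symbolI)
  fix t k q
  obtain r where r: "D ([:- t, 1:] ^ (m + k) * q) = [:- t, 1:] ^ k * r"
    "poly r t = fact (m + k) / fact k * poly s t * poly q t"
    using D by (rule has_symbolE)
  obtain r' where r': "E ([:- t, 1:] ^ (m + k) * q) = [:- t, 1:] ^ k * r'"
    "poly r' t = fact (m + k) / fact k * poly s' t * poly q t"
    using E by (rule has_symbolE)
  show "\<exists>r. D ([:- t, 1:] ^ (m + k) * q) + E ([:- t, 1:] ^ (m + k) * q) = [:- t, 1:] ^ k * r \<and>
     poly r t = fact (m + k) / fact k * poly (s + s') t * poly q t"
    by (rule exI[of _ "r + r'"]) (simp only: r r' poly_add distrib_left distrib_right simp_thms)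
qed

lemma has_symbol_sum:
  assumes "finite A" "\<And>i. i \<in> A \<Longrightarrow> has_symbol (D i) m (s i)"
  shows "has_symbol (\<lambda>p. \<Sum>i\<in>A. D i p) m (\<Sum>i\<in>A. s i)"
  using assms by (induction A) (auto intro: has_symbol_add has_symbol_0)

lemma has_symbol_mult:
  assumes D: "has_symbol D m s"
  shows "has_symbol (\<lambda>p. D p * g) m (s * g)"
proof (rule has_symbolI)
  fix t k q
  obtain r where "D ([:- t, 1:] ^ (m + k) * q) = [:- t, 1:] ^ k * r"
    "poly r t = fact (m + k) / fact k * poly s t * poly q t"
    using D by (rule has_symbolE)
  then show "\<exists>r. D ([:- t, 1:] ^ (m + k) * q) * g = [:- t, 1:] ^ k * r \<and>
     poly r t = fact (m + k) / fact k * poly (s * g) t * poly q t"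
    by (intro exI[of _ "r * g"]) (simp add: mult_ac)
qed

lemma has_symbol_comp:
  assumes D: "has_symbol D m s" and E: "has_symbol E m' s'"
  shows "has_symbol (\<lambda>p. E (D p)) (m + m') (s * s')"
proof (rule has_symbolI)
  fix t k q
  obtain r where r: "D ([:- t, 1:] ^ (m + (m' + k)) * q) = [:- t, 1:] ^ (m' + k) * r"
    "poly r t = fact (m + (m' + k)) / fact (m' + k) * poly s t * poly q t"
    using D by (rule has_symbolE)
  obtain r' where r': "E ([:- t, 1:] ^ (m' + k) * r) = [:- t, 1:] ^ k * r'"
    "poly r' t = fact (m' + k) / fact k * poly s' t * poly r t"
    using E by (rule has_symbolE)
  have "poly r' t = fact (m + m' + k) / fact k * poly (s * s') t * poly q t"
    unfolding r'(2) r(2) by (simp add: field_simps add.assoc)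
  then show "\<exists>r. E (D ([:- t, 1:] ^ (m + m' + k) * q)) = [:- t, 1:] ^ k * r \<and>
     poly r t = fact (m + m' + k) / fact k * poly (s * s') t * poly q t"
    using r(1) r'(1) by (metis add.assoc)
qed

lemma has_symbol_pderiv: "has_symbol pderiv 1 1"
proof (rule has_symbolI)
  fix t :: complex and k q
  have "pderiv ([:- t, 1:] ^ (1 + k) * q)
      = [:- t, 1:] ^ k * (smult (of_nat (Suc k)) q + [:- t, 1:] * pderiv q)"
  proof -
    define X :: "complex poly" where "X = [:- t, 1:]"
    have "pderiv X = 1"
      by (simp add: X_def pderiv_pCons)
    then have "pderiv (X ^ (1 + k) * q) = X ^ (1 + k) * pderiv q + q * smult (of_nat (Suc k)) (X ^ k)"
      by (simp only: pderiv_mult plus_1_eq_Suc pderiv_power_Suc mult_1_right)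
    then show ?thesis
      unfolding X_def[symmetric] by (simp add: distrib_left mult_ac del: of_nat_Suc)
  qed
  moreover have "poly (smult (of_nat (Suc k)) q + [:- t, 1:] * pderiv q) t
      = fact (1 + k) / fact k * poly 1 t * poly q t"
    by (simp del: of_nat_Suc)
  ultimately show "\<exists>r. pderiv ([:- t, 1:] ^ (1 + k) * q) = [:- t, 1:] ^ k * r \<and>
     poly r t = fact (1 + k) / fact k * poly 1 t * poly q t"
    by blast
qed

lemma has_symbol_id: "has_symbol (\<lambda>p. p) 0 1"
  by (rule has_symbolI) auto

lemma has_symbol_funpow:
  assumes "has_symbol D m s"
  shows "has_symbol (\<lambda>p. (D ^^ k) p) (k * m) (s ^ k)"
proof (induction k)
  case 0
  show ?case by (simp add: has_symbol_id)
next
  case (Suc k)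
  from has_symbol_comp[OF this assms] show ?case
    by (simp add: add.commute mult.commute)
qed

lemma has_symbol_op_poly:
  assumes "has_symbol D m s" "m > 0"
  shows "has_symbol (scalar_op_poly c D) (degree c * m) (smult (lead_coeff c) (s ^ degree c))"
proof -
  have "has_symbol (\<lambda>p. \<Sum>k\<le>degree c. (D ^^ k) p * [:coeff c k:]) (degree c * m)
          (\<Sum>k\<le>degree c. (if k = degree c then s ^ k else 0) * [:coeff c k:])"
  proof (intro has_symbol_sum has_symbol_mult finite_atMost)
    fix k assume "k \<in> {..degree c}"
    then show "has_symbol (D ^^ k) (degree c * m) (if k = degree c then s ^ k else 0)"
      using has_symbol_funpow[OF assms(1), of k] has_symbol_raise[of "D ^^ k" "k * m" "s ^ k" "degree c * m"] assms(2)
      by auto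
  qed
  also have "(\<Sum>k\<le>degree c. (if k = degree c then s ^ k else 0) * [:coeff c k:])
      = (\<Sum>k\<le>degree c. if k = degree c then s ^ k * [:coeff c k:] else 0)"
    by (rule sum.cong) auto
  finally show ?thesis
    by (simp add: scalar_op_poly_def[abs_def])
qed

text \<open>The order of \<open>D\<close> is the largest index with a nonzero coefficient, found by discarding vanishing
  top terms one at a time.\<close>
lemma scalar_ops_has_symbol:
  assumes "D \<in> scalar_ops"
  shows "D = (\<lambda>p. 0) \<or> (\<exists>m s. s \<noteq> 0 \<and> has_symbol D m s)"
proof -
  have "(\<lambda>p. \<Sum>j\<le>m. (pderiv ^^ j) p * f j) = (\<lambda>p. 0) \<or>
     (\<exists>m' s. s \<noteq> 0 \<and> m' \<le> m \<and> has_symbol (\<lambda>p. \<Sum>j\<le>m. (pderiv ^^ j) p * f j) m' s)" for m f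
  proof (induction m)
    case 0
    show ?case
      using has_symbol_mult[OF has_symbol_id, of "f 0"] by (cases "f 0 = 0") auto
  next
    case (Suc m)
    define D where "D = (\<lambda>p. \<Sum>j\<le>m. (pderiv ^^ j) p * f j)"
    show ?case
    proof (cases "f (Suc m) = 0")
      case True
      with Suc show ?thesis by (auto intro: le_SucI)
    next
      case False
      have top: "has_symbol (\<lambda>p. (pderiv ^^ Suc m) p * f (Suc m)) (Suc m) (f (Suc m))"
        using has_symbol_mult[OF has_symbol_funpow[OF has_symbol_pderiv, of "Suc m"], of "f (Suc m)"]
        by simp
      have "has_symbol D (Suc m) 0"
        using Suc has_symbol_0[of "Suc m"] has_symbol_raise[of D _ _ "Suc m"]
        unfolding D_def[symmetric] by (auto simp: less_Suc_eq_le)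
      from has_symbol_add[OF this top] False show ?thesis
        by (auto simp: D_def)
    qed
  qed
  then show ?thesis
    using assms unfolding scalar_ops_def by blast
qed

section \<open>Eigenvalues as polynomials in the degree\<close>
text \<open>The number is the falling factorial \<open>n (n - 1) \<dots> (n - j + 1)\<close> that \<open>\<partial>\<^sup>j\<close> produces from \<open>x\<^sup>n\<close>; it
  vanishes by itself when \<open>n < j\<close>, where the truncated \<open>n - j\<close> would give a wrong value.\<close>
lemma falling_factorial_poly:
  "\<exists>c :: complex poly. \<forall>n. poly c (of_nat n) = (if j \<le> n then pochhammer (of_nat (Suc (n - j))) j else 0)"
proof (intro exI allI)
  fix n
  have "poly (\<Prod>i<j. [:- of_nat i, 1:]) (of_nat n :: complex) = (\<Prod>i<j. of_nat n - of_nat i)"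
    by (simp add: poly_prod)
  also have "\<dots> = (if j \<le> n then pochhammer (of_nat (Suc (n - j))) j else 0)"
  proof (cases "j \<le> n")
    case True
    have "pochhammer (of_nat (Suc (n - j)) :: complex) j = (\<Prod>i<j. of_nat (Suc (n - j)) + of_nat (j - Suc i))"
      using prod.nat_diff_reindex[of "\<lambda>i. of_nat (Suc (n - j)) + of_nat i :: complex" j]
      by (simp only: pochhammer_prod atLeast0LessThan)
    also have "\<dots> = (\<Prod>i<j. of_nat n - of_nat i)"
      using True by (intro prod.cong) (auto simp: of_nat_diff)
    finally show ?thesis
      using True by simp
  next
    case False
    then show ?thesis
      by (auto intro!: bexI[of _ n])
  qed
  finally show "poly (\<Prod>i<j. [:- of_nat i, 1:]) (of_nat n :: complex)
      = (if j \<le> n then pochhammer (of_nat (Suc (n - j))) j else 0)" .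
qed

text \<open>The coefficient of \<open>x\<^sup>n\<close> in \<open>\<partial>\<^sup>j(x\<^sup>n) f\<^sub>j\<close> is the coefficient of \<open>x\<^sup>j\<close> in \<open>f\<^sub>j\<close> times a falling factorial
  of \<open>n\<close>.\<close>
lemma (in monic_basis) eigenvalue_polynomial:
  assumes D: "D \<in> scalar_ops" and eig: "\<And>n. D (p n) = smult (l n) (p n)"
  shows "\<exists>q. \<forall>n. l n = poly q (of_nat n)"
proof -
  obtain m f where Df: "D = (\<lambda>p. \<Sum>j\<le>m. (pderiv ^^ j) p * f j)"
    using D by (auto simp: scalar_ops_def)
  obtain c :: "nat \<Rightarrow> complex poly" where
    c: "\<And>j n. poly (c j) (of_nat n) = (if j \<le> n then pochhammer (of_nat (Suc (n - j))) j else 0)"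
    using falling_factorial_poly by metis
  have "l n = poly (\<Sum>j\<le>m. smult (coeff (f j) j) (c j)) (of_nat n)" for n
  proof -
    have "coeff ((pderiv ^^ j) (monom 1 n) * f j) n = coeff (f j) j * poly (c j) (of_nat n)" for j
    proof (cases "j \<le> n")
      case True
      then have "(pderiv ^^ j) (monom 1 n) = monom (pochhammer (of_nat (Suc (n - j))) j :: complex) (n - j)"
        by (intro poly_eqI) (auto simp: coeff_higher_pderiv)
      with True show ?thesis
        by (simp add: c coeff_monom_mult)
    next
      case False
      then have "(pderiv ^^ j) (monom 1 n :: complex poly) = 0"
        by (intro poly_eqI) (auto simp: coeff_higher_pderiv)
      with False show ?thesis by (simp add: c)
    qed
    then show ?thesis
      using coeff_eigenvalue[OF scalar_ops_linear[OF D] eig, of n]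
      by (simp add: Df coeff_sum poly_sum)
  qed
  then show ?thesis by blast
qed

text \<open>The splitting of \<open>q\<close> into its even and odd part under the reflection \<open>x \<mapsto> - s - x\<close>: the map
  \<open>x \<mapsto> - x (x + s)\<close> generates the invariant polynomials and \<open>2 x + s\<close> changes sign.\<close>
lemma reflection_decomposition:
  fixes q :: "complex poly"
  shows "\<exists>a b. \<forall>x. poly q x = poly a (- x * (x + s)) + (2 * x + s) * poly b (- x * (x + s))"
proof (induction q)
  case 0
  then show ?case by (intro exI[of _ 0]) simp
next
  case (pCons c q)
  then obtain a b where
    ab: "\<And>x. poly q x = poly a (- x * (x + s)) + (2 * x + s) * poly b (- x * (x + s))" by blast
  show ?case
  proof (intro exI allI)
    fix x
    define u where "u = - x * (x + s)"
    have q: "poly q x = poly a u + (2 * x + s) * poly b u"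
      unfolding u_def by (rule ab)
    have "poly ([:c:] - smult (s / 2) a + [:s\<^sup>2 / 2, - 2:] * b) u
        + (2 * x + s) * poly (smult (1 / 2) a - smult (s / 2) b) u
        = c + x * poly a u + (s\<^sup>2 / 2 - 2 * u - (2 * x + s) * (s / 2)) * poly b u"
      by (simp only: poly_add poly_diff poly_smult poly_mult poly_pCons poly_0 mult_zero_right add_0_right)
        (simp add: field_simps)
    also have "s\<^sup>2 / 2 - 2 * u - (2 * x + s) * (s / 2) = x * (2 * x + s)"
      unfolding u_def by (simp add: field_simps power2_eq_square)
    also have "c + x * poly a u + x * (2 * x + s) * poly b u = poly (pCons c q) x"
      using q by (simp add: algebra_simps)
    finally show "poly (pCons c q) x
        = poly ([:c:] - smult (s / 2) a + [:s\<^sup>2 / 2, - 2:] * b) (- x * (x + s))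
        + (2 * x + s) * poly (smult (1 / 2) a - smult (s / 2) b) (- x * (x + s))"
      unfolding u_def by (rule sym)
  qed
qed

lemma order_power:
  "q \<noteq> 0 \<Longrightarrow> order t (q ^ n) = n * order t (q :: complex poly)"
  by (induction n) (simp_all add: order_mult)

text \<open>Subtracting the even part \<open>a(\<delta>)\<close> leaves an operator \<open>E\<close> with odd eigenvalues
  \<open>(2 n + s) b(\<mu>\<^sub>n)\<close>. Because \<open>(2 n + s)\<^sup>2 = s\<^sup>2 - 4 \<mu>\<^sub>n\<close>, its square is \<open>c(\<delta>)\<close> with
  \<open>c = (s\<^sup>2 - 4 x) b\<^sup>2\<close> of odd degree. If \<open>E\<close> has leading coefficient \<open>f\<close>, then \<open>f\<^sup>2\<close> is a constant times
  \<open>\<sigma>\<close> to that odd degree, which is impossible at a simple zero \<open>t\<close> of \<open>\<sigma>\<close>.\<close>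
lemma (in monic_basis) eigenvalue_polynomial_of_quadratic:
  assumes D: "D \<in> scalar_ops" and eigD: "\<And>n. D (p n) = smult (l n) (p n)"
    and \<delta>: "\<delta> \<in> scalar_ops" and eig: "\<And>n. \<delta> (p n) = smult (- of_nat n * (of_nat n + s)) (p n)"
    and sym: "has_symbol \<delta> 2 \<sigma>" and t: "order t \<sigma> = 1" "\<sigma> \<noteq> 0"
  shows "\<exists>q. \<forall>n. l n = poly q (- of_nat n * (of_nat n + s))"
proof -
  obtain q where q: "\<And>n. l n = poly q (of_nat n)"
    using eigenvalue_polynomial[OF D eigD] by blast
  obtain a b where ab: "\<And>x. poly q x = poly a (- x * (x + s)) + (2 * x + s) * poly b (- x * (x + s))"
    using reflection_decomposition[of q s] by blast
  define E where "E = (\<lambda>r. D r + smult (- 1) (scalar_op_poly a \<delta> r))"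
  have E: "E \<in> scalar_ops"
    unfolding E_def by (intro scalar_ops_add scalar_ops_smult D scalar_ops_op_poly \<delta>)
  define c where "c = [:s\<^sup>2, - 4:] * b\<^sup>2"
  have eigE: "E (p n) = smult ((2 * of_nat n + s) * poly b (- of_nat n * (of_nat n + s))) (p n)" for n
    unfolding E_def scalar_op_poly_eigen[OF scalar_ops_linear[OF \<delta>] eig] eigD q ab
    by (simp flip: smult_diff_left)
  have "(\<lambda>r. E (E r)) = scalar_op_poly c \<delta>"
  proof (rule linear_eqI)
    fix n
    show "E (E (p n)) = scalar_op_poly c \<delta> (p n)"
      unfolding scalar_op_poly_eigen[OF scalar_ops_linear[OF \<delta>] eig] eigE
        module_hom.scale[OF scalar_ops_linear[OF E]]
      by (simp add: c_def poly_power power2_eq_square algebra_simps)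
  qed (auto intro: scalar_ops_linear scalar_ops_comp scalar_ops_op_poly E \<delta>)
  then have csym: "has_symbol (\<lambda>r. E (E r)) (degree c * 2) (smult (lead_coeff c) (\<sigma> ^ degree c))"
    using has_symbol_op_poly[OF sym, of c] by simp
  have "b = 0"
  proof (rule ccontr)
    assume b: "b \<noteq> 0"
    define X where "X = [:s\<^sup>2, - 4:]"
    have X: "X \<noteq> 0" "degree X = 1"
      by (simp_all add: X_def)
    have c: "c = X * b\<^sup>2"
      by (simp only: c_def X_def)
    have c0: "c \<noteq> 0"
      unfolding c by (intro no_zero_divisors power_not_zero X b)
    have deg: "degree c = 1 + 2 * degree b"
      unfolding c by (simp only: degree_mult_eq[OF X(1) power_not_zero[OF b]] degree_power_eq[OF b] X)
    have cs0: "smult (lead_coeff c) (\<sigma> ^ degree c) \<noteq> 0"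
      using c0 t by simp
    have "E \<noteq> (\<lambda>r. 0)"
    proof
      assume "E = (\<lambda>r. 0)"
      then have "has_symbol (\<lambda>r. E (E r)) (degree c * 2) 0"
        by (simp add: has_symbol_0)
      from has_symbol_unique[OF csym this] cs0 show False by simp
    qed
    then obtain m f where f: "f \<noteq> 0" "has_symbol E m f"
      using scalar_ops_has_symbol[OF E] by blast
    have EE: "has_symbol (\<lambda>r. E (E r)) (m + m) (f * f)"
      by (rule has_symbol_comp) (rule f)+
    have "m + m = degree c * 2"
      using has_symbol_order_unique[OF EE _ csym cs0] f(1) by simp
    with EE csym have "f * f = smult (lead_coeff c) (\<sigma> ^ degree c)"
      by (auto intro: has_symbol_unique)
    then have "order t (f * f) = order t (smult (lead_coeff c) (\<sigma> ^ degree c))"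
      by simp
    then have "2 * order t f = degree c"
      using f(1) c0 t by (simp add: order_mult order_smult order_power)
    with deg show False by presburger
  qed
  then show ?thesis
    using q ab by auto
qed

section \<open>Orthogonal polynomials of Pearson weights\<close>

lemma cnj_poly_mult: "map_poly cnj (p * q) = map_poly cnj p * map_poly cnj q"
  by (rule poly_eqI) (simp add: coeff_map_poly coeff_mult cnj_sum)

lemma cnj_poly_pderiv: "map_poly cnj (pderiv p) = pderiv (map_poly cnj p)"
  by (rule poly_eqI) (simp add: coeff_map_poly coeff_pderiv)

lemma cnj_poly_add: "map_poly cnj (p + q) = map_poly cnj p + map_poly cnj q"
  by (rule poly_eqI) (simp add: coeff_map_poly)

lemma cnj_poly_of_real: "map_poly cnj (map_poly of_real r) = map_poly of_real r"
  by (rule poly_eqI) (simp add: coeff_map_poly)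

lemma poly_of_real_map: "poly (map_poly of_real r) (of_real x :: complex) = of_real (poly r x)"
  by (induction r) (simp_all add: map_poly_pCons)

definition second_order_op :: "real poly \<Rightarrow> real poly \<Rightarrow> complex poly \<Rightarrow> complex poly" where
  "second_order_op \<sigma> \<tau> p = (pderiv ^^ 2) p * map_poly of_real \<sigma> + pderiv p * map_poly of_real \<tau>"

text \<open>The coefficient of \<open>x\<^sup>n\<close> in \<open>second_order_op \<sigma> \<tau> (x\<^sup>n)\<close> for \<open>deg \<sigma> \<le> 2\<close> and \<open>deg \<tau> \<le> 1\<close>.\<close>
definition quadratic_eigenvalue :: "real poly \<Rightarrow> real poly \<Rightarrow> nat \<Rightarrow> real" where
  "quadratic_eigenvalue \<sigma> \<tau> n = coeff \<sigma> 2 * (real n * (real n - 1)) + coeff \<tau> 1 * real n"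

lemma second_order_op_in_scalar_ops: "second_order_op \<sigma> \<tau> \<in> scalar_ops"
  unfolding second_order_op_def[abs_def]
  using scalar_ops_monomial[of 1] by (intro scalar_ops_add scalar_ops_monomial) simp_all

lemmas second_order_op_linear = scalar_ops_linear[OF second_order_op_in_scalar_ops]

text \<open>The Pearson equation \<open>(\<sigma> w)' = \<tau> w\<close> with vanishing boundary values is used only through the
  integrals of \<open>(\<sigma> w x\<^sup>k)'\<close>, so it is imposed in that integrated form, which covers weights on a
  line, a half-line and an interval alike. The interval \<open>(0, 1)\<close> is contained in all three supports,
  and positivity there already makes the inner product definite.\<close>
locale pearson_weight =
  fixes w :: "real \<Rightarrow> real" and \<sigma> \<tau> :: "real poly"
  assumes moments: "\<And>k. integrable lborel (\<lambda>x. w x * x ^ k)"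
    and nonneg: "\<And>x. 0 \<le> w x"
    and pos: "\<And>x. 0 < x \<Longrightarrow> x < 1 \<Longrightarrow> 0 < w x"
    and degree_\<sigma>: "degree \<sigma> \<le> 2" and degree_\<tau>: "degree \<tau> \<le> 1"
    and pearson: "\<And>k. (LINT x|lborel. w x * (poly \<sigma> x * (real k * x ^ (k - 1)) + poly \<tau> x * x ^ k)) = 0"
    and inj_eigenvalue: "inj (quadratic_eigenvalue \<sigma> \<tau>)"
begin

abbreviation "\<delta> \<equiv> second_order_op \<sigma> \<tau>"
abbreviation "\<mu> n \<equiv> complex_of_real (quadratic_eigenvalue \<sigma> \<tau> n)"

definition moment :: "complex poly \<Rightarrow> complex" where
  "moment r = (LINT x|lborel. poly r (of_real x) * of_real (w x))"

lemma integrable_poly: "integrable lborel (\<lambda>x. poly r (of_real x) * complex_of_real (w x))"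
proof -
  have "integrable lborel (\<lambda>x. \<Sum>i\<le>degree r. coeff r i * complex_of_real (w x * x ^ i))"
    by (intro Bochner_Integration.integrable_sum integrable_mult_right) (simp only: complex_of_real_integrable_eq moments)
  then show ?thesis
    by (simp add: poly_altdef sum_distrib_left mult_ac)
qed

lemma moment_add: "moment (p + q) = moment p + moment q"
  by (simp add: moment_def distrib_right integrable_poly)

lemma moment_smult: "moment (smult c p) = c * moment p"
  by (simp add: moment_def mult.assoc)

lemma moment_sum: "moment (\<Sum>i\<in>A. f i) = (\<Sum>i\<in>A. moment (f i))"
proof (induction A rule: infinite_finite_induct)
  case (insert x F)
  then show ?case by (simp add: moment_add)
qed (simp_all add: moment_def)

text \<open>The left side is linear in \<open>r\<close>, so the moments assumed in the locale suffice.\<close>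
lemma moment_pearson: "moment (pderiv r * map_poly of_real \<sigma> + r * map_poly of_real \<tau>) = 0"
proof -
  have mono: "moment (pderiv (monom 1 k) * map_poly of_real \<sigma> + monom 1 k * map_poly of_real \<tau>) = 0" for k
  proof -
    have "moment (pderiv (monom 1 k) * map_poly of_real \<sigma> + monom 1 k * map_poly of_real \<tau>)
      = (LINT x|lborel. complex_of_real (w x * (poly \<sigma> x * (real k * x ^ (k - 1)) + poly \<tau> x * x ^ k)))"
      unfolding moment_def
      by (intro Bochner_Integration.integral_cong) (simp_all add: pderiv_monom poly_monom poly_of_real_map algebra_simps)
    then show ?thesis
      by (simp only: integral_complex_of_real pearson of_real_0)
  qed
  define M where "M r = pderiv r * map_poly of_real \<sigma> + r * map_poly of_real \<tau>" for r :: "complex poly"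
  have M: "poly_linear M"
    by (rule poly_linearI) (simp_all add: M_def pderiv_add pderiv_smult algebra_simps smult_add_right)
  have "M r = M (\<Sum>i\<le>degree r. smult (coeff r i) (monom 1 i))"
    by (simp add: smult_monom poly_as_sum_of_monoms)
  also have "\<dots> = (\<Sum>i\<le>degree r. smult (coeff r i) (M (monom 1 i)))"
    by (simp only: module_hom.sum[OF M] module_hom.scale[OF M])
  finally have "moment (M r) = (\<Sum>i\<le>degree r. coeff r i * moment (M (monom 1 i)))"
    by (simp only: moment_sum moment_smult)
  then show ?thesis
    using mono by (simp add: M_def)
qed

lemma scalar_inner_moment: "scalar_inner w p q = moment (p * map_poly cnj q)"
proof -
  have "poly (map_poly cnj q) (of_real x) = cnj (poly q (of_real x))" for x
    by simp
  then show ?thesis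
    unfolding scalar_inner_def moment_def
    by (intro Bochner_Integration.integral_cong) (simp_all add: mult_ac)
qed

lemma inner_add: "scalar_inner w (p + q) r = scalar_inner w p r + scalar_inner w q r"
  by (simp add: scalar_inner_moment distrib_right moment_add)

lemma inner_smult: "scalar_inner w (smult c p) r = c * scalar_inner w p r"
  by (simp add: scalar_inner_moment moment_smult)

lemma inner_diff: "scalar_inner w (p - q) r = scalar_inner w p r - scalar_inner w q r"
  using inner_add[of p "smult (- 1) q" r] inner_smult[of "- 1" q r] by simp

lemma inner_sum: "scalar_inner w (\<Sum>i\<in>A. f i) r = (\<Sum>i\<in>A. scalar_inner w (f i) r)"
  by (simp add: scalar_inner_moment sum_distrib_right moment_sum)

lemma inner_smult_right: "scalar_inner w p (smult (of_real c) q) = of_real c * scalar_inner w p q"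
proof -
  have "map_poly cnj (smult (of_real c) q) = smult (of_real c) (map_poly cnj q)"
    by (rule poly_eqI) (simp add: coeff_map_poly)
  then show ?thesis
    by (simp add: scalar_inner_moment moment_smult)
qed

text \<open>The integrand \<open>\<bar>p\<bar>\<^sup>2 w\<close> would vanish almost everywhere, hence so would \<open>p\<close> on \<open>(0, 1)\<close>; but \<open>p\<close> has
  finitely many zeros.\<close>
lemma inner_definite:
  assumes "scalar_inner w p p = 0"
  shows "p = 0"
proof (rule ccontr)
  assume p: "p \<noteq> 0"
  let ?f = "\<lambda>x. (norm (poly p (complex_of_real x)))\<^sup>2 * w x"
  have f: "complex_of_real (?f x) = poly (p * map_poly cnj p) (of_real x) * of_real (w x)" for x
    by (simp add: complex_norm_square[symmetric])
  have "integrable lborel (\<lambda>x. complex_of_real (?f x))"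
    unfolding f by (rule integrable_poly)
  then have int: "integrable lborel ?f"
    by (simp only: complex_of_real_integrable_eq)
  have "complex_of_real (LINT x|lborel. ?f x) = scalar_inner w p p"
    by (simp only: integral_complex_of_real[symmetric] f scalar_inner_moment moment_def)
  then have "(LINT x|lborel. ?f x) = 0"
    using assms by simp
  then have "AE x in lborel. ?f x = 0"
    using integral_nonneg_eq_0_iff_AE[OF int] nonneg by simp
  moreover have "AE x in lborel. x \<notin> {x. poly p (complex_of_real x) = 0}"
  proof (rule AE_not_in)
    have "finite {x. poly p (complex_of_real x) = 0}"
      using finite_vimageI[OF poly_roots_finite[OF p], of complex_of_real]
      by (simp add: vimage_def inj_on_def)
    then show "{x. poly p (complex_of_real x) = 0} \<in> null_sets lborel"
      by (rule finite_imp_null_set_lborel)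
  qed
  ultimately have "AE x in lborel. x \<notin> {0<..<1::real}"
  proof eventually_elim
    case (elim x)
    then show ?case using pos[of x] by auto
  qed
  then have "{0<..<1::real} \<in> null_sets lborel"
    by (simp only: AE_iff_null_sets[symmetric] sets_lborel borel_open open_greaterThanLessThan)
  then show False by (simp add: null_sets_def)
qed

text \<open>The difference of the two sides is the moment of \<open>\<sigma> \<partial>r + \<tau> r\<close> for the Wronskian
  \<open>r = \<partial>p q' - p \<partial>q'\<close>, where \<open>q'\<close> is the conjugate of \<open>q\<close>.\<close>
lemma \<delta>_symmetric: "scalar_inner w (\<delta> p) q = scalar_inner w p (\<delta> q)"
proof -
  define q' where "q' = map_poly cnj q"
  define S T :: "complex poly" where "S = map_poly of_real \<sigma>" and "T = map_poly of_real \<tau>"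
  have cnj: "map_poly cnj (\<delta> q) = (pderiv ^^ 2) q' * S + pderiv q' * T"
    by (simp add: second_order_op_def numeral_2_eq_2 cnj_poly_add cnj_poly_mult cnj_poly_pderiv
        cnj_poly_of_real q'_def S_def T_def)
  have "\<delta> p * q' - p * map_poly cnj (\<delta> q)
      = pderiv (pderiv p * q' - p * pderiv q') * S + (pderiv p * q' - p * pderiv q') * T"
    unfolding cnj by (simp add: second_order_op_def numeral_2_eq_2 S_def[symmetric] T_def[symmetric]
        pderiv_diff pderiv_mult algebra_simps)
  then have "moment (\<delta> p * q' - p * map_poly cnj (\<delta> q)) = 0"
    unfolding S_def T_def by (simp only: moment_pearson)
  then have "moment (\<delta> p * q') + - 1 * moment (p * map_poly cnj (\<delta> q)) = 0"
    by (simp only: moment_smult[symmetric] moment_add[symmetric]) simp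
  then show ?thesis
    by (simp add: scalar_inner_moment q'_def)
qed

lemma \<delta>_triangular:
  assumes "n \<le> k"
  shows "coeff (\<delta> (monom 1 n) - smult (\<mu> n) (monom 1 n)) k = 0"
proof -
  have c1: "coeff (pderiv (monom 1 n) * map_poly of_real \<tau> :: complex poly) k = (if k = n then of_real (coeff \<tau> 1) * of_nat n else 0)"
    using assms degree_\<tau>
    by (cases n) (auto simp: pderiv_monom coeff_monom_mult coeff_map_poly coeff_eq_0 Suc_diff_le)
  have c2: "coeff ((pderiv ^^ 2) (monom 1 n) * map_poly of_real \<sigma> :: complex poly) k
      = (if k = n then of_real (coeff \<sigma> 2) * (of_nat n * (of_nat n - 1)) else 0)"
  proof (cases "n < 2")
    case True
    then show ?thesis
      by (cases n) (auto simp: numeral_2_eq_2 pderiv_monom)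
  next
    case False
    then obtain m where n: "n = Suc (Suc m)"
      by (metis add_2_eq_Suc le_Suc_ex not_less)
    show ?thesis
      using assms degree_\<sigma> unfolding n
      by (auto simp: numeral_2_eq_2 pderiv_monom coeff_monom_mult coeff_map_poly coeff_eq_0 Suc_diff_le)
  qed
  show ?thesis
    by (simp add: second_order_op_def c1 c2 quadratic_eigenvalue_def)
qed

text \<open>Correct \<open>x\<^sup>n\<close> by a combination of the lower eigenpolynomials. The equation for each coefficient
  has the factor \<open>\<mu> n - \<mu> k\<close>, which is nonzero because the eigenvalues are distinct.\<close>
lemma eigenpolynomial_exists: "\<exists>q. degree q = n \<and> coeff q n = 1 \<and> \<delta> q = smult (\<mu> n) q"
proof (induction n rule: less_induct)
  case (less n)
  then obtain f where f: "\<And>k. k < n \<Longrightarrow> degree (f k) = k \<and> coeff (f k) k = 1 \<and> \<delta> (f k) = smult (\<mu> k) (f k)"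
    by metis
  \<comment> \<open>Only the indices below \<open>n\<close> matter; the monomials complete them to a monic basis.\<close>
  interpret monic_basis "\<lambda>k. if k < n then f k else monom 1 k"
    by unfold_locales (auto simp: f degree_monom_eq)
  obtain c where "\<delta> (monom 1 n) - smult (\<mu> n) (monom 1 n)
      = (\<Sum>k<n. smult (c k) (if k < n then f k else monom 1 k))"
    using expand[of n, OF \<delta>_triangular] by blast
  then have c: "\<delta> (monom 1 n) = smult (\<mu> n) (monom 1 n) + (\<Sum>k<n. smult (c k) (f k))"
    by (simp add: algebra_simps)
  define d where "d k = c k / (\<mu> n - \<mu> k)" for k
  have d: "c k + d k * \<mu> k = \<mu> n * d k" if "k < n" for k
  proof -
    have "\<mu> n - \<mu> k \<noteq> 0"
      using injD[OF inj_eigenvalue, of n k] that by auto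
    then show ?thesis
      by (simp add: d_def field_simps)
  qed
  define g where "g = (\<Sum>k<n. smult (d k) (f k))"
  have g0: "coeff g k = 0" if "n \<le> k" for k
    using that f by (simp add: g_def coeff_sum coeff_eq_0)
  have "\<delta> (monom 1 n + g) = smult (\<mu> n) (monom 1 n) + (\<Sum>k<n. smult (c k) (f k))
      + (\<Sum>k<n. smult (d k * \<mu> k) (f k))"
    using f by (simp add: g_def c module_hom.add[OF second_order_op_linear]
        module_hom.sum[OF second_order_op_linear] module_hom.scale[OF second_order_op_linear])
  also have "\<dots> = smult (\<mu> n) (monom 1 n + g)"
    by (simp add: g_def smult_add_right smult_sum_right d sum.distrib[symmetric] smult_add_left[symmetric] add.assoc)
  finally have "\<delta> (monom 1 n + g) = smult (\<mu> n) (monom 1 n + g)" .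
  moreover have "coeff (monom 1 n + g) n = 1"
    by (simp add: g0)
  moreover have "degree (monom 1 n + g) = n"
    by (rule antisym[OF degree_le le_degree]) (use g0 in auto)
  ultimately show ?case by blast
qed

definition eigenpoly :: "nat \<Rightarrow> complex poly" where
  "eigenpoly n = (SOME q. degree q = n \<and> coeff q n = 1 \<and> \<delta> q = smult (\<mu> n) q)"

lemma eigenpoly: "degree (eigenpoly n) = n" "coeff (eigenpoly n) n = 1"
    "\<delta> (eigenpoly n) = smult (\<mu> n) (eigenpoly n)"
  using someI_ex[OF eigenpolynomial_exists] by (simp_all add: eigenpoly_def)

sublocale eigenpoly: monic_basis eigenpoly
  by unfold_locales (rule eigenpoly)+

lemma eigenpoly_orthogonal:
  assumes "m \<noteq> n"
  shows "scalar_inner w (eigenpoly m) (eigenpoly n) = 0"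
proof -
  have "\<mu> m * scalar_inner w (eigenpoly m) (eigenpoly n) = \<mu> n * scalar_inner w (eigenpoly m) (eigenpoly n)"
    using \<delta>_symmetric[of "eigenpoly m" "eigenpoly n"]
    by (simp only: eigenpoly(3) inner_smult inner_smult_right)
  moreover have "\<mu> m \<noteq> \<mu> n"
    using injD[OF inj_eigenvalue, of m n] assms by auto
  ultimately show ?thesis by simp
qed

text \<open>The expansion of \<open>p\<close> in the eigenpolynomials has coefficients proportional to the inner products
  with them.\<close>
lemma orthogonal_to_lower_imp_0:
  assumes "\<And>k. n \<le> k \<Longrightarrow> coeff p k = 0"
    and orth: "\<And>k. k < n \<Longrightarrow> scalar_inner w p (eigenpoly k) = 0"
  shows "p = 0"
proof -
  obtain c where c: "p = (\<Sum>k<n. smult (c k) (eigenpoly k))"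
    using eigenpoly.expand[of n p] assms(1) by blast
  have "c k = 0" if "k < n" for k
  proof -
    have "scalar_inner w p (eigenpoly k)
        = (\<Sum>j<n. c j * scalar_inner w (eigenpoly j) (eigenpoly k))"
      unfolding c by (simp add: inner_sum inner_smult)
    also have "\<dots> = (\<Sum>j<n. if j = k then c k * scalar_inner w (eigenpoly k) (eigenpoly k) else 0)"
      by (rule sum.cong) (auto simp: eigenpoly_orthogonal)
    finally show ?thesis
      using that orth inner_definite[of "eigenpoly k"] by auto
  qed
  then show ?thesis
    by (simp add: c)
qed

lemma monic_orthogonal_unique:
  assumes monic: "\<And>k. n < k \<Longrightarrow> coeff p k = 0" "coeff p n = 1"
    and orth: "\<And>k. k < n \<Longrightarrow> scalar_inner w p (eigenpoly k) = 0"
  shows "p = eigenpoly n"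
proof -
  have "p - eigenpoly n = 0"
  proof (rule orthogonal_to_lower_imp_0)
    fix k assume "n \<le> k"
    then show "coeff (p - eigenpoly n) k = 0"
      using monic by (cases "n = k") (auto simp: eigenpoly coeff_eq_0)
  next
    fix k assume "k < n"
    then show "scalar_inner w (p - eigenpoly n) (eigenpoly k) = 0"
      by (simp add: inner_diff orth eigenpoly_orthogonal)
  qed
  then show ?thesis by simp
qed

text \<open>The scalar orthogonal polynomials are defined by a unique description, so uniqueness has to be
  shown; it goes degree by degree, since a competitor that agrees with the eigenpolynomials below
  \<open>n\<close> is orthogonal to them in degree \<open>n\<close>.\<close>
lemma scalar_monic_ops_eq: "scalar_monic_ops w = eigenpoly"
  unfolding scalar_monic_ops_def
proof (rule the_equality)
  show "(\<forall>n. degree (eigenpoly n) = n \<and> lead_coeff (eigenpoly n) = 1) \<and>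
    (\<forall>m n. m \<noteq> n \<longrightarrow> scalar_inner w (eigenpoly m) (eigenpoly n) = 0)"
    by (auto simp: eigenpoly eigenpoly_orthogonal)
next
  fix p
  assume p: "(\<forall>n. degree (p n) = n \<and> lead_coeff (p n) = 1) \<and>
    (\<forall>m n. m \<noteq> n \<longrightarrow> scalar_inner w (p m) (p n) = 0)"
  have "p n = eigenpoly n" for n
  proof (induction n rule: less_induct)
    case (less n)
    have d: "degree (p n) = n" "lead_coeff (p n) = 1"
      using p by blast+
    show ?case
    proof (rule monic_orthogonal_unique)
      fix k assume "k < n"
      then show "scalar_inner w (p n) (eigenpoly k) = 0"
        using p less[of k] by (metis less_irrefl)
    qed (use d in \<open>auto intro: coeff_eq_0\<close>)
  qed
  then show "p = eigenpoly" by auto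
qed

end

section \<open>The three classical families satisfy Pearson equations\<close>
text \<open>The integrand is the derivative of \<open>x\<^sup>k \<sigma> g\<close>, so the integral is the difference of the boundary
  values. The smooth function \<open>g\<close> stands for the formula of the weight inside the interval; it
  avoids differentiating the case distinction by which the weight vanishes outside.\<close>
lemma integral_derivative_moment_eq_0:
  fixes a b :: ereal and k :: nat and g :: "real \<Rightarrow> real"
  defines "w \<equiv> (\<lambda>x. if x \<in> einterval a b then g x else 0)"
  assumes "a < b"
    and moments: "\<And>k. integrable lborel (\<lambda>x. w x * x ^ k)"
    and cont: "\<And>x. x \<in> einterval a b \<Longrightarrow> isCont g x"
    and deriv: "\<And>x. x \<in> einterval a b \<Longrightarrow> ((\<lambda>x. poly \<sigma> x * g x) has_real_derivative poly \<tau> x * g x) (at x)"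
    and lim_a: "(((\<lambda>x. x ^ k * (poly \<sigma> x * g x)) \<circ> real_of_ereal) \<longlongrightarrow> 0) (at_right a)"
    and lim_b: "(((\<lambda>x. x ^ k * (poly \<sigma> x * g x)) \<circ> real_of_ereal) \<longlongrightarrow> 0) (at_left b)"
  shows "(LINT x|lborel. w x * (poly \<sigma> x * (real k * x ^ (k - 1)) + poly \<tau> x * x ^ k)) = 0"
proof -
  let ?r = "\<lambda>x. poly \<sigma> x * (real k * x ^ (k - 1)) + poly \<tau> x * x ^ k"
  have ind: "indicator (einterval a b) x *\<^sub>R (g x * ?r x) = w x * ?r x" for x
    by (simp add: w_def)
  have poly_int: "integrable lborel (\<lambda>x. w x * poly r x)" for r
  proof -
    have "integrable lborel (\<lambda>x. \<Sum>i\<le>degree r. coeff r i * (w x * x ^ i))"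
      by (intro Bochner_Integration.integrable_sum integrable_mult_right moments)
    then show ?thesis
      by (simp add: poly_altdef sum_distrib_left mult_ac)
  qed
  have int: "integrable lborel (\<lambda>x. w x * ?r x)"
    using poly_int[of "\<sigma> * monom (real k) (k - 1) + \<tau> * monom 1 k"]
    by (simp add: poly_monom)
  have "(LBINT x=a..b. g x * ?r x) = 0 - 0"
  proof (rule interval_integral_FTC_integrable[OF \<open>a < b\<close> _ _ _ lim_a lim_b])
    fix x assume "a < ereal x" "ereal x < b"
    then have x: "x \<in> einterval a b"
      by (simp add: einterval_def)
    have "((\<lambda>x. x ^ k * (poly \<sigma> x * g x)) has_real_derivative g x * ?r x) (at x)"
      by (rule derivative_eq_intros deriv x refl | simp add: algebra_simps)+
    then show "((\<lambda>x. x ^ k * (poly \<sigma> x * g x)) has_vector_derivative g x * ?r x) (at x)"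
      by (simp only: has_real_derivative_iff_has_vector_derivative)
    show "isCont (\<lambda>x. g x * ?r x) x"
      by (intro continuous_intros cont x)
  next
    show "set_integrable lborel (einterval a b) (\<lambda>x. g x * ?r x)"
      unfolding set_integrable_def ind by (rule int)
  qed
  then show ?thesis
    unfolding interval_lebesgue_integral_def set_lebesgue_integral_def ind if_P[OF less_imp_le[OF \<open>a < b\<close>]]
    by (simp only: diff_self)
qed

text \<open>Completing the square turns the weight into a multiple of the normal density with mean \<open>b\<close> and
  variance \<open>1 / 2\<close>, whose central moments exist.\<close>
lemma hermite_moments: "integrable lborel (\<lambda>x. hermite_weight b x * x ^ k)"
proof -
  define s :: real where "s = 1 / sqrt 2"
  have s: "0 < s" "s\<^sup>2 = 1 / 2"
    by (simp_all add: s_def power_divide)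
  have e: "hermite_weight b x = (sqrt pi * exp (b\<^sup>2)) * normal_density b s x" for x
  proof -
    have "normal_density b s x = exp (- ((x - b)\<^sup>2)) / sqrt pi"
      by (simp add: normal_density_def s)
    moreover have "hermite_weight b x = exp (b\<^sup>2) * exp (- ((x - b)\<^sup>2))"
      unfolding hermite_weight_def exp_add[symmetric] by (simp add: power2_eq_square algebra_simps)
    ultimately show ?thesis by simp
  qed
  have "integrable lborel (\<lambda>x. \<Sum>i\<le>k. (sqrt pi * exp (b\<^sup>2) * real (k choose i) * b ^ (k - i)) * (normal_density b s x * (x - b) ^ i))"
    by (intro Bochner_Integration.integrable_sum integrable_mult_right integrable_normal_moment s)
  also have "(\<lambda>x. \<Sum>i\<le>k. (sqrt pi * exp (b\<^sup>2) * real (k choose i) * b ^ (k - i)) * (normal_density b s x * (x - b) ^ i))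
      = (\<lambda>x. hermite_weight b x * (\<Sum>i\<le>k. real (k choose i) * (x - b) ^ i * b ^ (k - i)))"
    unfolding e sum_distrib_left by (intro ext sum.cong) (simp_all add: mult_ac)
  also have "\<dots> = (\<lambda>x. hermite_weight b x * ((x - b) + b) ^ k)"
    by (simp only: binomial_ring)
  finally show ?thesis by simp
qed

lemma hermite_pearson_weight: "pearson_weight (hermite_weight b) [:1:] [:2 * b, - 2:]"
proof
  show "integrable lborel (\<lambda>x. hermite_weight b x * x ^ k)" for k
    by (rule hermite_moments)
  have w: "(if x \<in> einterval (-\<infinity>) \<infinity> then hermite_weight b x else 0) = hermite_weight b x" for x
    by simp
  show "(LINT x|lborel. hermite_weight b x *
      (poly [:1:] x * (real k * x ^ (k - 1)) + poly [:2 * b, - 2:] x * x ^ k)) = 0" for k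
  proof (rule integral_derivative_moment_eq_0[of "-\<infinity>" \<infinity> "hermite_weight b", unfolded w])
    show "isCont (hermite_weight b) x" for x
      unfolding hermite_weight_def[abs_def] by (intro continuous_intros)
    show "((\<lambda>x. poly [:1:] x * hermite_weight b x) has_real_derivative
        poly [:2 * b, - 2:] x * hermite_weight b x) (at x)" for x
      unfolding hermite_weight_def[abs_def] by (rule derivative_eq_intros refl | simp add: algebra_simps)+
    show "(((\<lambda>x. x ^ k * (poly [:1:] x * hermite_weight b x)) \<circ> real_of_ereal) \<longlongrightarrow> 0) (at_right (-\<infinity>))"
      unfolding ereal_tendsto_simps hermite_weight_def poly_pCons poly_0 by real_asymp
    show "(((\<lambda>x. x ^ k * (poly [:1:] x * hermite_weight b x)) \<circ> real_of_ereal) \<longlongrightarrow> 0) (at_left \<infinity>)"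
      unfolding ereal_tendsto_simps hermite_weight_def poly_pCons poly_0 by real_asymp
  qed (auto intro: hermite_moments)
  show "inj (quadratic_eigenvalue [:1:] [:2 * b, - 2:])"
    by (simp add: inj_def quadratic_eigenvalue_def numeral_2_eq_2)
qed (auto simp: hermite_weight_def)

text \<open>The moments are values of the Gamma integral.\<close>
lemma laguerre_moments:
  assumes "\<alpha> > - 1"
  shows "integrable lborel (\<lambda>x. laguerre_weight \<alpha> x * x ^ k)"
proof (rule integrableI_nonneg)
  have e: "laguerre_weight \<alpha> x * x ^ k = indicator {0..} x * x powr (\<alpha> + real k + 1 - 1) / exp x" for x
    by (auto simp: laguerre_weight_def powr_add powr_realpow exp_minus indicator_def field_simps)
  show "(\<lambda>x. laguerre_weight \<alpha> x * x ^ k) \<in> borel_measurable lborel"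
    unfolding e by measurable
  show "AE x in lborel. 0 \<le> laguerre_weight \<alpha> x * x ^ k"
    by (simp add: laguerre_weight_def)
  show "(\<integral>\<^sup>+ x. ennreal (laguerre_weight \<alpha> x * x ^ k) \<partial>lborel) < \<infinity>"
    unfolding e using assms by (subst Gamma_conv_nn_integral_real[symmetric]) auto
qed

lemma laguerre_pearson_weight:
  assumes "\<alpha> > - 1"
  shows "pearson_weight (laguerre_weight \<alpha>) [:0, 1:] [:\<alpha> + 1, - 1:]"
proof
  show "integrable lborel (\<lambda>x. laguerre_weight \<alpha> x * x ^ k)" for k
    using assms by (rule laguerre_moments)
  define g where "g x = exp (- x) * x powr \<alpha>" for x
  have w: "(if x \<in> einterval 0 \<infinity> then g x else 0) = laguerre_weight \<alpha> x" for x
    by (simp add: einterval_iff laguerre_weight_def g_def zero_ereal_def)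
  show "(LINT x|lborel. laguerre_weight \<alpha> x *
      (poly [:0, 1:] x * (real k * x ^ (k - 1)) + poly [:\<alpha> + 1, - 1:] x * x ^ k)) = 0" for k
  proof (rule integral_derivative_moment_eq_0[of 0 \<infinity> g, unfolded w])
    fix x :: real assume "x \<in> einterval 0 \<infinity>"
    then have x: "x > 0"
      by (simp add: einterval_iff zero_ereal_def)
    show "isCont g x"
      unfolding g_def[abs_def] using x by (intro continuous_intros) auto
    show "((\<lambda>x. poly [:0, 1:] x * g x) has_real_derivative poly [:\<alpha> + 1, - 1:] x * g x) (at x)"
      unfolding g_def[abs_def] using x
      by (auto intro!: derivative_eq_intros simp: powr_diff field_simps)
  next
    have "((\<lambda>x. x ^ k * (poly [:0, 1:] x * g x)) \<longlongrightarrow> 0) (at_right 0)"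
      unfolding g_def poly_pCons poly_0 using assms by real_asymp
    then show "(((\<lambda>x. x ^ k * (poly [:0, 1:] x * g x)) \<circ> real_of_ereal) \<longlongrightarrow> 0) (at_right 0)"
      unfolding zero_ereal_def ereal_tendsto_simps .
    show "(((\<lambda>x. x ^ k * (poly [:0, 1:] x * g x)) \<circ> real_of_ereal) \<longlongrightarrow> 0) (at_left \<infinity>)"
      unfolding ereal_tendsto_simps g_def poly_pCons poly_0 using assms by real_asymp
  qed (auto intro: laguerre_moments assms)
  show "inj (quadratic_eigenvalue [:0, 1:] [:\<alpha> + 1, - 1:])"
    by (simp add: inj_def quadratic_eigenvalue_def numeral_2_eq_2)
qed (auto simp: laguerre_weight_def)

text \<open>The substitution \<open>t = (1 + x) / 2\<close> turns the weight into the integrand of the Beta integral, and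
  \<open>\<bar>x\<^sup>k\<bar> \<le> 1\<close> on the support.\<close>
lemma jacobi_moments:
  assumes "\<alpha> > - 1" "\<beta> > - 1"
  shows "integrable lborel (\<lambda>x. jacobi_weight \<alpha> \<beta> x * x ^ k)"
proof (rule Bochner_Integration.integrable_bound)
  have "integrable lborel (\<lambda>t. indicator {0..1} t * (t powr (\<beta> + 1 - 1) * (1 - t) powr (\<alpha> + 1 - 1)))"
    using integrable_Beta[of "\<beta> + 1" "\<alpha> + 1"] assms by (simp add: set_integrable_def)
  from lborel_integrable_real_affine[OF this, of "1 / 2" "1 / 2"]
  have "integrable lborel (\<lambda>x. 2 powr \<alpha> * 2 powr \<beta> * (indicator {0..1} (1 / 2 + 1 / 2 * x) *
      ((1 / 2 + 1 / 2 * x) powr (\<beta> + 1 - 1) * (1 - (1 / 2 + 1 / 2 * x)) powr (\<alpha> + 1 - 1))))"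
    by (intro integrable_mult_right) simp
  moreover have "2 powr \<alpha> * 2 powr \<beta> * (indicator {0..1} (1 / 2 + 1 / 2 * x) *
      ((1 / 2 + 1 / 2 * x) powr (\<beta> + 1 - 1) * (1 - (1 / 2 + 1 / 2 * x)) powr (\<alpha> + 1 - 1)))
      = jacobi_weight \<alpha> \<beta> x" for x :: real
  proof (cases "- 1 < x \<and> x < 1")
    case True
    have half: "1 / 2 + 1 / 2 * x = (1 + x) / 2" "1 - (1 + x) / 2 = (1 - x) / 2"
      by (simp_all add: field_simps)
    show ?thesis
      unfolding half using True by (simp add: jacobi_weight_def powr_divide)
  next
    case False
    then have "x = 1 \<or> x = - 1 \<or> 1 / 2 + 1 / 2 * x \<notin> {0..1}"
      by (auto simp: field_simps)
    with False show ?thesis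
      by (auto simp: jacobi_weight_def)
  qed
  ultimately show int: "integrable lborel (jacobi_weight \<alpha> \<beta>)"
    by (simp only:)
  then have [measurable]: "jacobi_weight \<alpha> \<beta> \<in> borel_measurable lborel"
    by (rule borel_measurable_integrable)
  show "(\<lambda>x. jacobi_weight \<alpha> \<beta> x * x ^ k) \<in> borel_measurable lborel"
    by measurable
  have "norm (jacobi_weight \<alpha> \<beta> x * x ^ k) \<le> norm (jacobi_weight \<alpha> \<beta> x)" for x
  proof (cases "- 1 < x \<and> x < 1")
    case True
    then have "\<bar>x\<bar> ^ k \<le> 1"
      by (intro power_le_one) auto
    then show ?thesis
      by (simp add: abs_mult power_abs mult_left_le)
  next
    case False
    then show ?thesis
      by (auto simp: jacobi_weight_def)
  qed
  then show "AE x in lborel. norm (jacobi_weight \<alpha> \<beta> x * x ^ k) \<le> norm (jacobi_weight \<alpha> \<beta> x)"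
    by simp
qed

lemma jacobi_quadratic_eigenvalue:
  "quadratic_eigenvalue [:1, 0, - 1:] [:\<beta> - \<alpha>, - (\<alpha> + \<beta> + 2):] n = - real n * (real n + (\<alpha> + \<beta> + 1))"
  by (simp add: quadratic_eigenvalue_def numeral_2_eq_2 algebra_simps)

lemma jacobi_pearson_weight:
  assumes "\<alpha> > - 1" "\<beta> > - 1"
  shows "pearson_weight (jacobi_weight \<alpha> \<beta>) [:1, 0, - 1:] [:\<beta> - \<alpha>, - (\<alpha> + \<beta> + 2):]"
proof
  show "integrable lborel (\<lambda>x. jacobi_weight \<alpha> \<beta> x * x ^ k)" for k
    using assms by (rule jacobi_moments)
  define g where "g x = (1 - x) powr \<alpha> * (1 + x) powr \<beta>" for x :: real
  have w: "(if x \<in> einterval (ereal (- 1)) (ereal 1) then g x else 0) = jacobi_weight \<alpha> \<beta> x" for x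
    by (simp add: einterval_iff jacobi_weight_def g_def)
  show "(LINT x|lborel. jacobi_weight \<alpha> \<beta> x *
      (poly [:1, 0, - 1:] x * (real k * x ^ (k - 1)) + poly [:\<beta> - \<alpha>, - (\<alpha> + \<beta> + 2):] x * x ^ k)) = 0" for k
  proof (rule integral_derivative_moment_eq_0[of "ereal (- 1)" "ereal 1" g, unfolded w])
    fix x :: real assume "x \<in> einterval (ereal (- 1)) (ereal 1)"
    then have x: "- 1 < x" "x < 1"
      by (simp_all add: einterval_iff)
    show "isCont g x"
      unfolding g_def[abs_def] using x by (intro continuous_intros) auto
    have p: "(1 - x) powr (\<alpha> - 1) = (1 - x) powr \<alpha> / (1 - x)" "(1 + x) powr (\<beta> - 1) = (1 + x) powr \<beta> / (1 + x)"
      using x by (simp_all add: powr_diff)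
    show "((\<lambda>x. poly [:1, 0, - 1:] x * g x) has_real_derivative
        poly [:\<beta> - \<alpha>, - (\<alpha> + \<beta> + 2):] x * g x) (at x)"
      unfolding g_def[abs_def] using x
      by (auto intro!: derivative_eq_intros simp: p divide_simps) (simp add: algebra_simps)
  next
    \<comment> \<open>The limits at \<open>-1\<close> and \<open>1\<close> are taken in the distance from the endpoint, as limits at \<open>0\<close>.\<close>
    have "((\<lambda>x. x ^ k) \<longlongrightarrow> (- 1) ^ k) (at_right (- 1 :: real))"
      by (intro tendsto_intros)
    moreover have "((\<lambda>x. (2 - x) * x * ((2 - x) powr \<alpha> * x powr \<beta>)) \<longlongrightarrow> 0) (at_right 0)"
      using assms by real_asymp
    then have "((\<lambda>x. poly [:1, 0, - 1:] x * g x) \<longlongrightarrow> 0) (at_right (- 1))"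
      unfolding filterlim_at_right_to_0[of _ _ "- 1"] by (simp add: g_def algebra_simps)
    ultimately have "((\<lambda>x. x ^ k * (poly [:1, 0, - 1:] x * g x)) \<longlongrightarrow> (- 1) ^ k * 0) (at_right (- 1))"
      by (rule tendsto_mult)
    then have "((\<lambda>x. x ^ k * (poly [:1, 0, - 1:] x * g x)) \<longlongrightarrow> 0) (at_right (- 1))"
      by (simp only: mult_zero_right)
    then show "(((\<lambda>x. x ^ k * (poly [:1, 0, - 1:] x * g x)) \<circ> real_of_ereal) \<longlongrightarrow> 0) (at_right (ereal (- 1)))"
      unfolding ereal_tendsto_simps .
    have "((\<lambda>x. (1 - x) ^ k * ((2 - x) * x * (x powr \<alpha> * (2 - x) powr \<beta>))) \<longlongrightarrow> 0) (at_right 0)"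
      using assms by real_asymp
    then have "((\<lambda>x. x ^ k * (poly [:1, 0, - 1:] x * g x)) \<longlongrightarrow> 0) (at_left 1)"
      unfolding filterlim_at_left_to_right[of _ _ 1] filterlim_at_right_to_0[of _ _ "- 1"]
      by (simp add: g_def algebra_simps)
    then show "(((\<lambda>x. x ^ k * (poly [:1, 0, - 1:] x * g x)) \<circ> real_of_ereal) \<longlongrightarrow> 0) (at_left (ereal 1))"
      unfolding ereal_tendsto_simps .
  qed (auto intro: jacobi_moments assms)
  show "inj (quadratic_eigenvalue [:1, 0, - 1:] [:\<beta> - \<alpha>, - (\<alpha> + \<beta> + 2):])"
    unfolding inj_def jacobi_quadratic_eigenvalue
  proof (intro allI impI)
    fix m n :: nat
    assume "- real m * (real m + (\<alpha> + \<beta> + 1)) = - real n * (real n + (\<alpha> + \<beta> + 1))"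
    then have "(real m - real n) * (real m + real n + (\<alpha> + \<beta> + 1)) = 0"
      by (simp add: algebra_simps)
    moreover have "real m + real n + (\<alpha> + \<beta> + 1) > 0" if "m \<noteq> n"
    proof -
      \<comment> \<open>Distinctness uses \<open>\<alpha> + \<beta> + 1 > - 1\<close>, the worst case being \<open>m + n = 1\<close>.\<close>
      have "real m + real n \<ge> 1"
        using that by linarith
      then show ?thesis using assms by linarith
    qed
    ultimately show "m = n" by force
  qed
qed (auto simp: jacobi_weight_def)

lemma hermite_op_second_order: "hermite_op b = second_order_op [:1:] [:2 * b, - 2:]"
proof
  fix p
  show "hermite_op b p = second_order_op [:1:] [:2 * b, - 2:] p"
    unfolding hermite_op_def second_order_op_def
    by (simp add: map_poly_pCons numeral_poly algebra_simps smult_add_right smult_diff_right)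
qed

lemma laguerre_op_second_order: "laguerre_op \<alpha> = second_order_op [:0, 1:] [:\<alpha> + 1, - 1:]"
  by (simp add: fun_eq_iff laguerre_op_def second_order_op_def map_poly_pCons)

lemma jacobi_op_second_order:
  "jacobi_op \<alpha> \<beta> = second_order_op [:1, 0, - 1:] [:\<beta> - \<alpha>, - (\<alpha> + \<beta> + 2):]"
  by (simp add: fun_eq_iff jacobi_op_def second_order_op_def map_poly_pCons)

section \<open>Eigenvalues of the classical operators\<close>
text \<open>Reading the eigenvalue off the action on \<open>x\<^sup>n\<close> makes it a function of the operator alone, so that
  eigenvalues of operators belonging to different weights can be compared.\<close>
definition eigenvalue :: "(complex poly \<Rightarrow> complex poly) \<Rightarrow> nat \<Rightarrow> complex" where
  "eigenvalue \<delta> n = coeff (\<delta> (monom 1 n)) n"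

lemma classical_pearson_weight:
  assumes "classical w \<delta>"
  shows "\<exists>\<sigma> \<tau>. pearson_weight w \<sigma> \<tau> \<and> \<delta> = second_order_op \<sigma> \<tau>"
  using assms
proof cases
  case (hermite b)
  then show ?thesis using hermite_pearson_weight hermite_op_second_order by blast
next
  case (laguerre \<alpha>)
  then show ?thesis using laguerre_pearson_weight laguerre_op_second_order by blast
next
  case (jacobi \<alpha> \<beta>)
  then show ?thesis using jacobi_pearson_weight jacobi_op_second_order by blast
qed

lemma (in pearson_weight) monic_basis_scalar_monic_ops: "monic_basis (scalar_monic_ops w)"
  unfolding scalar_monic_ops_eq by (rule eigenpoly.monic_basis_axioms)

lemma (in pearson_weight) eigenvalue_second_order_op:
  "eigenvalue (second_order_op \<sigma> \<tau>) n = of_real (quadratic_eigenvalue \<sigma> \<tau> n)"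
  unfolding eigenvalue_def by (rule eigenpoly.coeff_eigenvalue[OF second_order_op_linear eigenpoly(3)])

lemma (in pearson_weight) second_order_op_eigen:
  "second_order_op \<sigma> \<tau> (scalar_monic_ops w n)
    = smult (eigenvalue (second_order_op \<sigma> \<tau>) n) (scalar_monic_ops w n)"
  unfolding eigenvalue_second_order_op scalar_monic_ops_eq by (rule eigenpoly(3))

lemma classical_monic_basis: "classical w \<delta> \<Longrightarrow> monic_basis (scalar_monic_ops w)"
  using classical_pearson_weight pearson_weight.monic_basis_scalar_monic_ops by blast

lemma classical_scalar_ops: "classical w \<delta> \<Longrightarrow> \<delta> \<in> scalar_ops"
  using classical_pearson_weight second_order_op_in_scalar_ops by metis

lemma classical_eigen:
  "classical w \<delta> \<Longrightarrow> \<delta> (scalar_monic_ops w n) = smult (eigenvalue \<delta> n) (scalar_monic_ops w n)"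
  using classical_pearson_weight pearson_weight.second_order_op_eigen by metis

lemma classical_inj_eigenvalue:
  assumes "classical w \<delta>"
  shows "inj (eigenvalue \<delta>)"
proof -
  obtain \<sigma> \<tau> where "pearson_weight w \<sigma> \<tau>" and \<delta>: "\<delta> = second_order_op \<sigma> \<tau>"
    using classical_pearson_weight[OF assms] by blast
  then interpret pearson_weight w \<sigma> \<tau> by simp
  show ?thesis
    using inj_eigenvalue by (simp add: \<delta> inj_def eigenvalue_second_order_op)
qed

lemma hermite_eigenvalue: "eigenvalue (hermite_op b) = (\<lambda>n. - 2 * of_nat n)"
  by (rule ext) (simp add: hermite_op_second_order quadratic_eigenvalue_def numeral_2_eq_2
      pearson_weight.eigenvalue_second_order_op[OF hermite_pearson_weight])

lemma laguerre_eigenvalue: "\<alpha> > - 1 \<Longrightarrow> eigenvalue (laguerre_op \<alpha>) = (\<lambda>n. - of_nat n)"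
  by (rule ext) (simp add: laguerre_op_second_order quadratic_eigenvalue_def numeral_2_eq_2
      pearson_weight.eigenvalue_second_order_op[OF laguerre_pearson_weight])

lemma jacobi_op_eigenvalue:
  "\<alpha> > - 1 \<Longrightarrow> \<beta> > - 1 \<Longrightarrow>
    eigenvalue (jacobi_op \<alpha> \<beta>) n = - of_nat n * (of_nat n + of_real (\<alpha> + \<beta> + 1))"
  using pearson_weight.eigenvalue_second_order_op[OF jacobi_pearson_weight, of \<alpha> \<beta> n]
  by (simp only: jacobi_op_second_order jacobi_quadratic_eigenvalue) simp

lemma jacobi_op_symbol: "has_symbol (jacobi_op \<alpha> \<beta>) 2 [:1, 0, - 1:]"
proof -
  have 1: "has_symbol (\<lambda>p. (pderiv ^^ 2) p * [:1, 0, - 1:]) 2 [:1, 0, - 1:]"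
    using has_symbol_mult[OF has_symbol_funpow[OF has_symbol_pderiv, of 2], of "[:1, 0, - 1:]"] by simp
  have 2: "has_symbol (\<lambda>p. pderiv p * g) 2 0" for g
    using has_symbol_raise[OF has_symbol_mult[OF has_symbol_pderiv], of 2 g] by simp
  show ?thesis
    unfolding jacobi_op_def[abs_def] using has_symbol_add[OF 1 2] by (simp only: add_0_right)
qed

text \<open>Hence every operator that has the \<open>p\<^sub>n\<close> as eigenvectors is a polynomial in \<open>\<delta>\<close>. In the Hermite and
  Laguerre cases \<open>n\<close> is a linear function of the eigenvalue of \<open>\<delta>\<close>. In the Jacobi case the leading
  coefficient \<open>1 - x\<^sup>2\<close> of \<open>\<delta>\<close> has a simple zero at \<open>1\<close>, so the obstruction by squares applies.\<close>
lemma eigenvalue_is_polynomial_in_classical_eigenvalue: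
  assumes cl: "classical w \<delta>" and D: "D \<in> scalar_ops"
    and eig: "\<And>n. D (scalar_monic_ops w n) = smult (l n) (scalar_monic_ops w n)"
  shows "\<exists>q. \<forall>n. l n = poly q (eigenvalue \<delta> n)"
proof -
  interpret monic_basis "scalar_monic_ops w"
    using cl by (rule classical_monic_basis)
  obtain q where q: "\<And>n. l n = poly q (of_nat n)"
    using eigenvalue_polynomial[OF D eig] by blast
  from cl show ?thesis
  proof cases
    case (hermite b)
    then have "l n = poly (pcompose q [:0, - 1 / 2:]) (eigenvalue \<delta> n)" for n
      by (simp add: q poly_pcompose hermite_eigenvalue)
    then show ?thesis by blast
  next
    case (laguerre \<alpha>)
    then have "l n = poly (pcompose q [:0, - 1:]) (eigenvalue \<delta> n)" for n
      by (simp add: q poly_pcompose laguerre_eigenvalue)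
    then show ?thesis by blast
  next
    case (jacobi \<alpha> \<beta>)
    have fac: "[:1, 0, - 1:] = [:- 1, 1:] * ([:- 1, - 1:] :: complex poly)"
      by simp
    have "order 1 ([:1, 0, - 1:] :: complex poly) = 1"
      unfolding fac by (subst order_mult) (simp_all add: order_0I order_power_n_n[of 1 1, simplified])
    moreover have "[:1, 0, - 1:] \<noteq> (0 :: complex poly)"
      by simp
    ultimately show ?thesis
      using eigenvalue_polynomial_of_quadratic[OF D eig classical_scalar_ops[OF cl], of "of_real (\<alpha> + \<beta> + 1)"]
        classical_eigen[OF cl] jacobi_op_symbol jacobi_op_eigenvalue jacobi by metis
  qed
qed

section \<open>Darboux equivalent classical weights have equal eigenvalues\<close>
lemma weight_support_hermite: "weight_support (hermite_weight b) = UNIV"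
  by (simp add: weight_support_def hermite_weight_def)

lemma weight_support_laguerre: "weight_support (laguerre_weight \<alpha>) = {0..}"
proof -
  have "{x. laguerre_weight \<alpha> x \<noteq> 0} = {0<..}"
    by (auto simp: laguerre_weight_def)
  then show ?thesis by (simp add: weight_support_def)
qed

lemma weight_support_jacobi: "weight_support (jacobi_weight \<alpha> \<beta>) = {- 1..1}"
proof -
  have "{x. jacobi_weight \<alpha> \<beta> x \<noteq> 0} = {- 1<..<1}"
    by (auto simp: jacobi_weight_def)
  then show ?thesis by (simp add: weight_support_def)
qed

lemma darboux_intertwiner:
  assumes d: "darboux w w'" and b: "monic_basis (scalar_monic_ops w)"
  obtains V a where "V \<in> scalar_ops" "\<And>n. a n \<noteq> 0"
    "\<And>n. V (scalar_monic_ops w n) = smult (a n) (scalar_monic_ops w' n)"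
proof -
  interpret monic_basis "scalar_monic_ops w" by (rule b)
  obtain V a where V: "V \<in> scalar_ops" "degree_preserving V"
    and a: "\<And>n. V (scalar_monic_ops w n) = smult (a n) (scalar_monic_ops w' n)"
    using d unfolding darboux_def by blast
  have "a n \<noteq> 0" for n
  proof
    assume "a n = 0"
    then have "V (scalar_monic_ops w n) = 0"
      by (simp add: a)
    with V(2) p_nonzero[of n] show False
      unfolding degree_preserving_def by blast
  qed
  with V a show ?thesis using that by blast
qed

text \<open>Besides \<open>D = V N\<close>, the operator \<open>V \<delta>' N\<close> also has the \<open>p\<^sub>n\<close> as eigenvectors. The eigenvalues \<open>\<lambda>\<^sub>n\<close>
  and \<open>\<lambda>\<^sub>n \<mu>'\<^sub>n\<close> of the two are polynomials in \<open>- n (n + s)\<close>, so both are invariant under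
  \<open>n \<mapsto> - s - n\<close>. Dividing by \<open>\<lambda>\<^sub>n\<close>, which is nonzero since \<open>V\<close> and \<open>N\<close> preserve degrees, shows that
  \<open>\<mu>'\<^sub>n = - n (n + s')\<close> has the same symmetry.\<close>
lemma darboux_jacobi_sum_eq:
  assumes ab: "\<alpha> > - 1" "\<beta> > - 1" and ab': "\<alpha>' > - 1" "\<beta>' > - 1"
    and d: "darboux (jacobi_weight \<alpha> \<beta>) (jacobi_weight \<alpha>' \<beta>')"
  shows "\<alpha> + \<beta> = \<alpha>' + \<beta>'"
proof -
  define w w' \<delta> \<delta>' where "w = jacobi_weight \<alpha> \<beta>" and "w' = jacobi_weight \<alpha>' \<beta>'"
    and "\<delta> = jacobi_op \<alpha> \<beta>" and "\<delta>' = jacobi_op \<alpha>' \<beta>'"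
  define s s' :: complex where "s = of_real (\<alpha> + \<beta> + 1)" and "s' = of_real (\<alpha>' + \<beta>' + 1)"
  have cl: "classical w \<delta>" and cl': "classical w' \<delta>'"
    using ab ab' by (auto simp: w_def w'_def \<delta>_def \<delta>'_def intro: classical.jacobi)
  have ev: "eigenvalue \<delta> n = - of_nat n * (of_nat n + s)" "eigenvalue \<delta>' n = - of_nat n * (of_nat n + s')" for n
    using jacobi_op_eigenvalue ab ab' by (simp_all only: \<delta>_def \<delta>'_def s_def s'_def)
  interpret monic_basis "scalar_monic_ops w"
    using cl by (rule classical_monic_basis)
  obtain D V N a where D: "D \<in> scalar_D w" and V: "V \<in> scalar_ops" "degree_preserving V"
    and N: "N \<in> scalar_ops" "degree_preserving N" and DVN: "D = op_mult V N"
    and a: "\<And>n. V (scalar_monic_ops w n) = smult (a n) (scalar_monic_ops w' n)"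
    using d unfolding darboux_def w_def w'_def by blast
  obtain l where l: "\<And>n. D (scalar_monic_ops w n) = smult (l n) (scalar_monic_ops w n)"
    using D unfolding scalar_D_def by (auto dest!: choice)
  have l0: "l n \<noteq> 0" for n
  proof
    assume "l n = 0"
    then have "N (V (scalar_monic_ops w n)) = 0"
      using l[of n] by (simp add: DVN op_mult_def)
    with V(2) N(2) p_nonzero[of n] show False
      unfolding degree_preserving_def by blast
  qed
  obtain q where q: "\<And>n. l n = poly q (eigenvalue \<delta> n)"
    using eigenvalue_is_polynomial_in_classical_eigenvalue[OF cl _ l] D by (auto simp: scalar_D_def)
  have eigN: "N (\<delta>' (V (scalar_monic_ops w n))) = smult (eigenvalue \<delta>' n * l n) (scalar_monic_ops w n)" for n
  proof -
    have "\<delta>' (V (scalar_monic_ops w n)) = smult (eigenvalue \<delta>' n) (V (scalar_monic_ops w n))"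
      unfolding a module_hom.scale[OF scalar_ops_linear[OF classical_scalar_ops[OF cl']]] classical_eigen[OF cl']
      by (simp add: mult.commute)
    then show ?thesis
      using l[of n] by (simp add: module_hom.scale[OF scalar_ops_linear[OF N(1)]] DVN op_mult_def)
  qed
  have ops: "(\<lambda>x. N (\<delta>' (V x))) \<in> scalar_ops"
    by (rule scalar_ops_comp[OF scalar_ops_comp[OF V(1) classical_scalar_ops[OF cl']] N(1)])
  obtain r where r: "\<And>n. eigenvalue \<delta>' n * l n = poly r (eigenvalue \<delta> n)"
    using eigenvalue_is_polynomial_in_classical_eigenvalue[OF cl ops eigN] by blast
  define u u' :: "complex poly" where "u = [:0, - s, - 1:]" and "u' = [:0, - s', - 1:]"
  have u: "poly u x = - x * (x + s)" "poly u' x = - x * (x + s')" for x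
    by (simp_all add: u_def u'_def algebra_simps)
  have poly_eq: "f = g" if "\<And>n. poly f (of_nat n) = poly g (of_nat n)" for f g :: "complex poly"
  proof (rule ccontr)
    assume "f \<noteq> g"
    then have "finite {x. poly (f - g) x = 0}"
      by (intro poly_roots_finite) simp
    moreover have "range (of_nat :: nat \<Rightarrow> complex) \<subseteq> {x. poly (f - g) x = 0}"
      using that by auto
    ultimately show False
      using range_inj_infinite[of "of_nat :: nat \<Rightarrow> complex"] inj_of_nat finite_subset by blast
  qed
  have "u' * pcompose q u = pcompose r u"
    by (rule poly_eq) (use r q ev in \<open>simp add: poly_pcompose u\<close>)
  then have id: "poly u' x * poly q (poly u x) = poly r (poly u x)" for x
    by (metis poly_mult poly_pcompose)
  have refl: "poly u (- s - x) = poly u x" for x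
    by (simp add: u algebra_simps)
  \<comment> \<open>The reflected points are no longer degrees, so this needs the identity of polynomials.\<close>
  have "poly u' (- s - of_nat n) = poly u' (of_nat n)" for n
  proof -
    have "poly q (poly u (of_nat n)) \<noteq> 0"
      using l0[of n] q[of n] by (simp only: ev u) simp
    moreover have "poly u' (- s - of_nat n) * poly q (poly u (of_nat n))
        = poly u' (of_nat n) * poly q (poly u (of_nat n))"
      using id[of "- s - of_nat n"] id[of "of_nat n"] by (simp only: refl)
    ultimately show ?thesis by simp
  qed
  from this[of 0] this[of 1] have "s * (s' - s) = 0" "(s + 2) * (s' - s) = 0"
    by (simp_all add: u algebra_simps)
  then have "s = s'"
    by (cases "s = 0") auto
  then show ?thesis
    by (simp only: s_def s'_def of_real_eq_iff)
qed

lemma darboux_eigenvalue_eq: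
  assumes cl: "classical w \<delta>" and cl': "classical w' \<delta>'" and d: "darboux w w'"
  shows "eigenvalue \<delta> = eigenvalue \<delta>'"
proof -
  have supp: "weight_support w = weight_support w'"
    using d by (simp add: darboux_def)
  have neq: "UNIV \<noteq> {0::real..}" "UNIV \<noteq> {- 1..1::real}" "{0::real..} \<noteq> {- 1..1::real}"
  proof -
    have "- 1 \<notin> {0::real..}" "2 \<notin> {- 1..1::real}" "2 \<in> {0::real..}" by simp_all
    then show "UNIV \<noteq> {0::real..}" "UNIV \<noteq> {- 1..1::real}" "{0::real..} \<noteq> {- 1..1::real}" by blast+
  qed
  from cl show ?thesis
  proof cases
    case (hermite b)
    from cl' show ?thesis
      by cases (use supp hermite neq in \<open>simp_all add: hermite_eigenvalue weight_support_hermite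
          weight_support_laguerre weight_support_jacobi\<close>)
  next
    case (laguerre \<alpha>)
    from cl' show ?thesis
      by cases (use supp laguerre neq[symmetric] neq in \<open>simp_all add: laguerre_eigenvalue weight_support_hermite
          weight_support_laguerre weight_support_jacobi\<close>)
  next
    case (jacobi \<alpha> \<beta>)
    from cl' show ?thesis
    proof cases
      case (jacobi \<alpha>' \<beta>')
      have "\<alpha> + \<beta> = \<alpha>' + \<beta>'"
        using darboux_jacobi_sum_eq d jacobi \<open>w = jacobi_weight \<alpha> \<beta>\<close> \<open>\<alpha> > - 1\<close> \<open>\<beta> > - 1\<close> by blast
      then show ?thesis
        unfolding \<open>\<delta> = jacobi_op \<alpha> \<beta>\<close> jacobi(2)
        by (intro ext) (simp only: jacobi_op_eigenvalue \<open>\<alpha> > - 1\<close> \<open>\<beta> > - 1\<close> jacobi)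
    qed (use supp jacobi neq[symmetric] in \<open>simp_all add: weight_support_hermite
          weight_support_laguerre weight_support_jacobi\<close>)
  qed
qed

section \<open>Matrix differential operators and their entries\<close>
text \<open>Since operators act on the right, the entry \<open>d i j\<close> maps column \<open>i\<close> of the argument into column \<open>j\<close>
  of the result, within each row.\<close>
definition mat_op_of :: "('n::finite \<Rightarrow> 'n \<Rightarrow> complex poly \<Rightarrow> complex poly) \<Rightarrow> 'n mat_op" where
  "mat_op_of d P = (\<chi> a j. \<Sum>i\<in>UNIV. d i j (P $ a $ i))"

lemma mat_op_of_nth: "mat_op_of d P $ a $ j = (\<Sum>i\<in>UNIV. d i j (P $ a $ i))"
  by (simp add: mat_op_of_def)

lemma mderiv_pow_nth: "(mderiv ^^ k) P $ a $ b = (pderiv ^^ k) (P $ a $ b)"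
  by (induction k) (simp_all add: mderiv_def)

lemma mat_opsI: "D = (\<lambda>P. \<Sum>j\<le>m. (mderiv ^^ j) P ** F j) \<Longrightarrow> D \<in> mat_ops"
  unfolding mat_ops_def by blast

text \<open>The entries are finitely many, so the maximum of their orders serves all of them.\<close>
lemma mat_op_of_in_mat_ops:
  fixes d :: "'n::finite \<Rightarrow> 'n \<Rightarrow> complex poly \<Rightarrow> complex poly"
  assumes "\<And>i j. d i j \<in> scalar_ops"
  shows "mat_op_of d \<in> mat_ops"
proof -
  have "\<exists>m f. \<forall>M\<ge>m. d i j = (\<lambda>p. \<Sum>k\<le>M. (pderiv ^^ k) p * f k)" for i j
    using scalar_ops_extend[OF assms[of i j]] by metis
  then obtain m f where d: "\<And>i j M. m i j \<le> M \<Longrightarrow> d i j = (\<lambda>p. \<Sum>k\<le>M. (pderiv ^^ k) p * f i j k)"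
    by metis
  define M where "M = Max (range (\<lambda>(i, j). m i j))"
  have "m i j \<le> M" for i j
    unfolding M_def by (rule Max_ge) (auto intro: image_eqI[of _ _ "(i, j)"])
  then have d: "d i j = (\<lambda>p. \<Sum>k\<le>M. (pderiv ^^ k) p * f i j k)" for i j
    using d by blast
  have "mat_op_of d = (\<lambda>P. \<Sum>k\<le>M. (mderiv ^^ k) P ** (\<chi> i j. f i j k))"
  proof (intro ext vec_eq_iff[THEN iffD2] allI)
    fix P :: "'n matpoly" and a j
    have "mat_op_of d P $ a $ j = (\<Sum>i\<in>UNIV. \<Sum>k\<le>M. (pderiv ^^ k) (P $ a $ i) * f i j k)"
      by (simp add: mat_op_of_def d)
    also have "\<dots> = (\<Sum>k\<le>M. \<Sum>i\<in>UNIV. (pderiv ^^ k) (P $ a $ i) * f i j k)"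
      by (rule sum.swap)
    finally show "mat_op_of d P $ a $ j = (\<Sum>k\<le>M. (mderiv ^^ k) P ** (\<chi> i j. f i j k)) $ a $ j"
      by (simp add: matrix_matrix_mult_def mderiv_pow_nth)
  qed
  then show ?thesis
    by (rule mat_opsI)
qed

lemma mat_ops_entries:
  assumes "D \<in> mat_ops"
  obtains d where "\<And>i j. d i j \<in> scalar_ops" "D = mat_op_of d"
proof -
  obtain m F where D: "D = (\<lambda>P. \<Sum>k\<le>m. (mderiv ^^ k) P ** F k)"
    using assms by (auto simp: mat_ops_def)
  show ?thesis
  proof (rule that)
    show "(\<lambda>p. \<Sum>k\<le>m. (pderiv ^^ k) p * F k $ i $ j) \<in> scalar_ops" for i j
      by (rule scalar_opsI) rule
    show "D = mat_op_of (\<lambda>i j p. \<Sum>k\<le>m. (pderiv ^^ k) p * F k $ i $ j)"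
    proof (intro ext vec_eq_iff[THEN iffD2] allI)
      fix P a j
      have "D P $ a $ j = (\<Sum>k\<le>m. \<Sum>i\<in>UNIV. (pderiv ^^ k) (P $ a $ i) * F k $ i $ j)"
        by (simp add: D matrix_matrix_mult_def mderiv_pow_nth)
      also have "\<dots> = (\<Sum>i\<in>UNIV. \<Sum>k\<le>m. (pderiv ^^ k) (P $ a $ i) * F k $ i $ j)"
        by (rule sum.swap)
      finally show "D P $ a $ j = mat_op_of (\<lambda>i j p. \<Sum>k\<le>m. (pderiv ^^ k) p * F k $ i $ j) P $ a $ j"
        by (simp add: mat_op_of_def)
    qed
  qed
qed

lemma diag_op_eq_mat_op_of:
  fixes D :: "'n::finite \<Rightarrow> complex poly \<Rightarrow> complex poly"
  shows "diag_op D = mat_op_of (\<lambda>i j. if i = j then D j else (\<lambda>p. 0))"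
proof (intro ext vec_eq_iff[THEN iffD2] allI)
  fix P :: "'n matpoly" and a j
  have "(\<Sum>i\<in>UNIV. (if i = j then D j else (\<lambda>p. 0)) (P $ a $ i))
      = (\<Sum>i\<in>UNIV. if i = j then D j (P $ a $ j) else 0)"
    by (rule sum.cong) auto
  then show "diag_op D P $ a $ j = mat_op_of (\<lambda>i j. if i = j then D j else (\<lambda>p. 0)) P $ a $ j"
    by (simp add: diag_op_def mat_op_of_def)
qed

lemma mat_op_poly_diag_op: "mat_op_poly q (diag_op D) = diag_op (\<lambda>j. scalar_op_poly q (D j))"
proof -
  have pow: "(diag_op D ^^ k) P $ a $ j = (D j ^^ k) (P $ a $ j)" for k P a j
    by (induction k) (simp_all add: diag_op_def)
  show ?thesis
  proof (intro ext vec_eq_iff[THEN iffD2] allI)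
    fix P a j
    have "diag_op (\<lambda>j. scalar_op_poly q (D j)) P $ a $ j = scalar_op_poly q (D j) (P $ a $ j)"
      by (simp add: diag_op_def)
    then show "mat_op_poly q (diag_op D) P $ a $ j = diag_op (\<lambda>j. scalar_op_poly q (D j)) P $ a $ j"
      by (simp add: mat_op_poly_def scalar_op_poly_def msmult_def pow)
  qed
qed

section \<open>Orthogonal polynomials and operators of a direct sum\<close>
lemma integrable_vec:
  fixes f :: "'a \<Rightarrow> 'b::euclidean_space ^ 'n::finite"
  assumes "\<And>i. integrable M (\<lambda>x. f x $ i)"
  shows "integrable M f"
proof -
  have lin: "bounded_linear (axis i :: 'b \<Rightarrow> 'b ^ 'n)" for i
    unfolding linear_conv_bounded_linear[symmetric] by (rule linearI) (auto simp: axis_def vec_eq_iff)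
  have "integrable M (\<lambda>x. \<Sum>i\<in>UNIV. axis i (f x $ i))"
    by (intro Bochner_Integration.integrable_sum integrable_bounded_linear[OF lin] assms)
  moreover have "(\<Sum>i\<in>UNIV. axis i (f x $ i)) = f x" for x
    by (simp add: vec_eq_iff axis_def if_distrib cong: if_cong)
  ultimately show ?thesis by simp
qed

lemma integral_vec_nth:
  fixes f :: "'a \<Rightarrow> 'b::euclidean_space ^ 'n::finite"
  assumes "integrable M f"
  shows "(LINT x|M. f x) $ i = (LINT x|M. f x $ i)"
  using integral_bounded_linear[OF bounded_linear_vec_nth assms] by simp

lemma mat_inner_direct_sum_nth:
  fixes w :: "'n::finite \<Rightarrow> real \<Rightarrow> real"
  assumes "\<And>k. pearson_weight (w k) (\<sigma> k) (\<tau> k)"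
  shows "mat_inner (direct_sum w) P Q $ i $ j = (\<Sum>k\<in>UNIV. scalar_inner (w k) (P $ i $ k) (Q $ j $ k))"
proof -
  let ?F = "\<lambda>x. meval P x ** direct_sum w x ** adjoint_mat (meval Q x)"
  let ?g = "\<lambda>i j k x. poly (P $ i $ k) (of_real x) * of_real (w k x) * cnj (poly (Q $ j $ k) (of_real x))"
  have F: "?F x $ i $ j = (\<Sum>k\<in>UNIV. ?g i j k x)" for x i j
  proof -
    have "(meval P x ** direct_sum w x) $ i $ k = poly (P $ i $ k) (of_real x) * of_real (w k x)" for k
      by (simp add: matrix_matrix_mult_def meval_def direct_sum_def if_distrib cong: if_cong)
    then show ?thesis
      by (simp add: matrix_matrix_mult_def[of "_ ** _"] adjoint_mat_def meval_def[of Q])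
  qed
  have int: "integrable lborel (?g i j k)" for i j k
    using pearson_weight.integrable_poly[OF assms[of k], of "P $ i $ k * map_poly cnj (Q $ j $ k)"]
    by (simp add: mult_ac)
  have intij: "integrable lborel (\<lambda>x. ?F x $ i $ j)" for i j
    unfolding F by (intro Bochner_Integration.integrable_sum int)
  have inti: "integrable lborel (\<lambda>x. ?F x $ i)" for i
    by (rule integrable_vec) (rule intij)
  have "mat_inner (direct_sum w) P Q $ i $ j = (LINT x|lborel. ?F x $ i $ j)"
    unfolding mat_inner_def by (simp only: integral_vec_nth integrable_vec inti intij)
  also have "\<dots> = (\<Sum>k\<in>UNIV. scalar_inner (w k) (P $ i $ k) (Q $ j $ k))"
    unfolding F scalar_inner_def by (intro Bochner_Integration.integral_sum int)
  finally show ?thesis .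
qed

text \<open>Pairing \<open>P\<close> with a diagonal matrix of orthogonal polynomials pairs the entry \<open>(i, j)\<close> of \<open>P\<close> with
  the orthogonal polynomial of \<open>w j\<close>. So the uniqueness statement splits into scalar ones: a
  diagonal entry is monic and orthogonal to lower degrees, and an entry off the diagonal has lower
  degree and is orthogonal to that degree range, hence is zero.\<close>
lemma mat_monic_ops_direct_sum:
  fixes w :: "'n::finite \<Rightarrow> real \<Rightarrow> real"
  assumes pw: "\<And>k. pearson_weight (w k) (\<sigma> k) (\<tau> k)"
  shows "mat_monic_ops (direct_sum w) = (\<lambda>n. \<chi> i j. if i = j then scalar_monic_ops (w j) n else 0)"
proof -
  define e where "e k = pearson_weight.eigenpoly (\<sigma> k) (\<tau> k)" for k
  have e_ops: "scalar_monic_ops (w k) = e k" for k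
    unfolding e_def by (rule pearson_weight.scalar_monic_ops_eq[OF pw])
  have e: "degree (e k n) = n" "coeff (e k n) n = 1" for k n
    unfolding e_def by (rule pearson_weight.eigenpoly[OF pw])+
  have orth: "m \<noteq> n \<Longrightarrow> scalar_inner (w k) (e k m) (e k n) = 0" for k m n
    unfolding e_def by (rule pearson_weight.eigenpoly_orthogonal[OF pw])
  have zero: "scalar_inner (w k) p 0 = 0" "scalar_inner (w k) 0 p = 0" for k p
    by (simp_all add: scalar_inner_def)
  define E where "E n = (\<chi> i j. if i = j then e j n else 0)" for n
  have inner_E: "mat_inner (direct_sum w) P (E n) $ i $ j = scalar_inner (w j) (P $ i $ j) (e j n)" for P n i j
  proof -
    have "mat_inner (direct_sum w) P (E n) $ i $ j
        = (\<Sum>k\<in>UNIV. if k = j then scalar_inner (w j) (P $ i $ j) (e j n) else 0)"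
      unfolding mat_inner_direct_sum_nth[OF pw] by (rule sum.cong) (auto simp: E_def zero)
    then show ?thesis by simp
  qed
  have "mat_monic_ops (direct_sum w) = E"
    unfolding mat_monic_ops_def
  proof (rule the_equality)
    have "mat_inner (direct_sum w) (E m) (E n) = 0" if "m \<noteq> n" for m n
      using that by (simp add: vec_eq_iff inner_E) (simp add: E_def orth zero)
    then show "(\<forall>n. mat_monic n (E n)) \<and> (\<forall>m n. m \<noteq> n \<longrightarrow> mat_inner (direct_sum w) (E m) (E n) = 0)"
      by (auto simp: mat_monic_def E_def vec_eq_iff mat_def e)
  next
    fix P :: "nat \<Rightarrow> 'n matpoly"
    assume P: "(\<forall>n. mat_monic n (P n)) \<and> (\<forall>m n. m \<noteq> n \<longrightarrow> mat_inner (direct_sum w) (P m) (P n) = 0)"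
    have "P n = E n" for n
    proof (induction n rule: less_induct)
      case (less n)
      have P_orth: "scalar_inner (w j) (P n $ i $ j) (e j k) = 0" if "k < n" for i j k
        using P that less[OF that] inner_E[of "P n" k i j] by (metis less_irrefl zero_index)
      have monic: "coeff (P n $ i $ j) n = (if i = j then 1 else 0)" "degree (P n $ i $ j) \<le> n" for i j
        using P by (auto simp: mat_monic_def vec_eq_iff mat_def)
      have "P n $ i $ j = (if i = j then e j n else 0)" for i j
      proof (cases "i = j")
        case True
        have "P n $ i $ j = e j n"
          unfolding e_def
          by (rule pearson_weight.monic_orthogonal_unique[OF pw])
            (use True monic[of i j] P_orth in \<open>auto simp: e_def intro: coeff_eq_0\<close>)
        with True show ?thesis by simp
      next
        case False
        have "P n $ i $ j = 0"
        proof (rule pearson_weight.orthogonal_to_lower_imp_0[OF pw])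
          fix k assume "n \<le> k"
          then show "coeff (P n $ i $ j) k = 0"
            using False monic[of i j] by (cases "k = n") (auto intro: coeff_eq_0)
        next
          fix k assume "k < n"
          then show "scalar_inner (w j) (P n $ i $ j) (pearson_weight.eigenpoly (\<sigma> j) (\<tau> j) k) = 0"
            using P_orth by (simp add: e_def)
        qed
        with False show ?thesis by simp
      qed
      then show ?case
        by (simp add: vec_eq_iff E_def)
    qed
    then show "P = E" by auto
  qed
  then show ?thesis
    by (simp add: fun_eq_iff E_def e_ops)
qed

lemma scalar_op_0: "D \<in> scalar_ops \<Longrightarrow> D 0 = 0"
  using module_hom.zero[OF scalar_ops_linear] .

lemma mat_op_of_in_mat_D_iff:
  fixes w :: "'n::finite \<Rightarrow> real \<Rightarrow> real"
  assumes ops: "mat_monic_ops (direct_sum w) = (\<lambda>n. \<chi> i j. if i = j then p j n else 0)"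
    and d: "\<And>i j. d i j \<in> scalar_ops"
  shows "mat_op_of d \<in> mat_D (direct_sum w) \<longleftrightarrow> (\<forall>i j n. \<exists>c. d i j (p i n) = smult c (p j n))"
proof -
  let ?E = "\<lambda>n. \<chi> i j. if i = j then p j n else 0"
  have L: "mat_op_of d (?E n) $ a $ j = d a j (p a n)" for n a j
  proof -
    have "mat_op_of d (?E n) $ a $ j = (\<Sum>i\<in>UNIV. if i = a then d a j (p a n) else 0)"
      unfolding mat_op_of_nth by (rule sum.cong) (auto simp: scalar_op_0 d)
    then show ?thesis by simp
  qed
  have R: "(mconst \<Lambda> ** ?E n) $ a $ j = smult (\<Lambda> $ a $ j) (p j n)" for \<Lambda> n a j
    by (simp add: matrix_matrix_mult_def mconst_def if_distrib cong: if_cong)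
  have "mat_op_of d \<in> mat_D (direct_sum w) \<longleftrightarrow> (\<forall>n. \<exists>\<Lambda>. \<forall>i j. d i j (p i n) = smult (\<Lambda> $ i $ j) (p j n))"
    using mat_op_of_in_mat_ops[of d] d
    by (simp add: mat_D_def ops vec_eq_iff[of "mat_op_of d _"] vec_eq_iff[of "_ $ _"] L R)
  also have "\<dots> \<longleftrightarrow> (\<forall>i j n. \<exists>c. d i j (p i n) = smult c (p j n))"
  proof (intro iffI allI)
    fix n assume "\<forall>i j n. \<exists>c. d i j (p i n) = smult c (p j n)"
    then have "\<forall>i j. \<exists>c. d i j (p i n) = smult c (p j n)"
      by blast
    then obtain c where "\<And>i j. d i j (p i n) = smult (c i j) (p j n)"
      unfolding choice_iff by blast
    then show "\<exists>\<Lambda>. \<forall>i j. d i j (p i n) = smult (\<Lambda> $ i $ j) (p j n)"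
      by (intro exI[of _ "\<chi> i j. c i j"]) simp
  qed blast
  finally show ?thesis .
qed

lemma diag_op_inject: "diag_op D = diag_op E \<Longrightarrow> D = E"
proof (intro ext)
  fix j x assume "diag_op D = diag_op E"
  then have "diag_op D (\<chi> a b. x) $ j $ j = diag_op E (\<chi> a b. x) $ j $ j"
    by simp
  then show "D j x = E j x"
    by (simp add: diag_op_def)
qed

section \<open>The centre\<close>
text \<open>For an operator \<open>V\<close> that maps \<open>p i n\<close> to multiples of \<open>p j n\<close>, the matrix operator with the single
  entry \<open>V\<close> at \<open>(i, j)\<close> lies in the algebra. Commuting with it gives \<open>V (d i i x) = d j j (V x)\<close> and
  \<open>V (d c i x) = 0\<close> for \<open>c \<noteq> i\<close>. The identity as \<open>V\<close>, with \<open>i = j\<close>, yields that a central operator is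
  diagonal; the intertwiners, whose factors \<open>a n\<close> do not vanish, then equate the eigenvalues of
  its diagonal entries.\<close>
lemma center_of_intertwined_family:
  fixes w :: "'n::finite \<Rightarrow> real \<Rightarrow> real" and p :: "'n \<Rightarrow> nat \<Rightarrow> complex poly"
  assumes ops: "mat_monic_ops (direct_sum w) = (\<lambda>n. \<chi> i j. if i = j then p j n else 0)"
    and basis: "\<And>j. monic_basis (p j)"
    and \<delta>: "\<And>j. \<delta> j \<in> scalar_ops" and eig: "\<And>j n. \<delta> j (p j n) = smult (\<mu> n) (p j n)"
    and intertwiner: "\<And>i j. \<exists>V\<in>scalar_ops. \<exists>a. \<forall>n. a n \<noteq> 0 \<and> V (p i n) = smult (a n) (p j n)"
    and centralizer: "\<And>j D l. D \<in> scalar_ops \<Longrightarrow> (\<And>n. D (p j n) = smult (l n) (p j n))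
      \<Longrightarrow> \<exists>q. \<forall>n. l n = poly q (\<mu> n)"
  shows "mat_Z (direct_sum w) = {diag_op (\<lambda>j. scalar_op_poly q (\<delta> j)) | q. True}"
proof (intro equalityI subsetI)
  fix D assume "D \<in> mat_Z (direct_sum w)"
  then have D: "D \<in> mat_D (direct_sum w)" and comm: "\<And>E. E \<in> mat_D (direct_sum w) \<Longrightarrow> op_mult D E = op_mult E D"
    by (auto simp: mat_Z_def)
  obtain d where d: "\<And>i j. d i j \<in> scalar_ops" and Dd: "D = mat_op_of d"
    using D by (auto simp: mat_D_def elim: mat_ops_entries)
  have key: "V (d c i x) = (if c = i then d j j (V x) else 0)"
    if V: "V \<in> scalar_ops" and Vp: "\<And>n. \<exists>a. V (p i n) = smult a (p j n)" for V c i j x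
  proof -
    define e where "e k l = (if k = i \<and> l = j then V else (\<lambda>p. 0))" for k l
    have e: "e k l \<in> scalar_ops" for k l
      by (simp add: e_def V scalar_ops_0)
    have "mat_op_of e \<in> mat_D (direct_sum w)"
      unfolding mat_op_of_in_mat_D_iff[OF ops e]
    proof (intro allI)
      fix k l n
      show "\<exists>a. e k l (p k n) = smult a (p l n)"
        using Vp[of n] by (cases "k = i \<and> l = j") (auto simp: e_def intro: exI[of _ 0])
    qed
    then have "op_mult D (mat_op_of e) = op_mult (mat_op_of e) D"
      by (rule comm)
    then have eq: "mat_op_of e (D P) $ i $ j = D (mat_op_of e P) $ i $ j" for P
      by (simp add: op_mult_def fun_eq_iff)
    \<comment> \<open>Filling only column \<open>c\<close> isolates the entries \<open>d c _\<close>; any row may be inspected.\<close>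
    define P :: "'n matpoly" where "P = (\<chi> r s. if s = c then x else 0)"
    have e_nth: "mat_op_of e Q $ i $ l = (if l = j then V (Q $ i $ i) else 0)" for Q l
    proof -
      have "mat_op_of e Q $ i $ l = (\<Sum>k\<in>UNIV. if k = i then (if l = j then V (Q $ i $ i) else 0) else 0)"
        unfolding mat_op_of_nth by (rule sum.cong) (auto simp: e_def)
      then show ?thesis by simp
    qed
    have "D P $ i $ i = (\<Sum>k\<in>UNIV. if k = c then d c i x else 0)"
      unfolding Dd mat_op_of_nth by (rule sum.cong) (auto simp: P_def scalar_op_0 d)
    then have DP: "D P $ i $ i = d c i x"
      by simp
    have "D (mat_op_of e P) $ i $ j = (\<Sum>k\<in>UNIV. d k j (mat_op_of e P $ i $ k))"
      by (simp add: Dd mat_op_of_def[of d])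
    also have "\<dots> = (\<Sum>k\<in>UNIV. if k = j then (if c = i then d j j (V x) else 0) else 0)"
      by (rule sum.cong) (auto simp: e_nth P_def scalar_op_0 d V)
    finally show ?thesis
      using eq[of P] by (simp add: e_nth DP)
  qed
  have off: "d c j x = 0" if "c \<noteq> j" for c j x
    using key[OF scalar_ops_id, of j j c x] that by (metis smult_1_left)
  have "\<forall>j n. \<exists>c. d j j (p j n) = smult c (p j n)"
    using D mat_op_of_in_mat_D_iff[OF ops d] by (simp add: Dd)
  then obtain l where l: "\<And>j n. d j j (p j n) = smult (l j n) (p j n)"
    unfolding choice_iff by blast
  have l_eq: "l i n = l j n" for i j n
  proof -
    obtain V a where V: "V \<in> scalar_ops" and a: "\<And>n. a n \<noteq> 0" "\<And>n. V (p i n) = smult (a n) (p j n)"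
      using intertwiner[of i j] by blast
    have "V (d i i (p i n)) = d j j (V (p i n))"
      using key[OF V, of i j i "p i n"] a(2) by auto
    then have "smult (l i n * a n) (p j n) = smult (a n * l j n) (p j n)"
      by (simp add: l a module_hom.scale[OF scalar_ops_linear[OF V]] module_hom.scale[OF scalar_ops_linear[OF d]])
    then show ?thesis
      using a(1)[of n] monic_basis.p_nonzero[OF basis, of j n] by (simp add: smult_cancel_poly)
  qed
  \<comment> \<open>The eigenvalues agree for all indices, so one polynomial found at \<open>i0\<close> works for all.\<close>
  fix i0 :: 'n
  obtain q where q: "\<And>n. l i0 n = poly q (\<mu> n)"
    using centralizer[OF d l] by blast
  have "d j j = scalar_op_poly q (\<delta> j)" for j
  proof (rule monic_basis.linear_eqI[OF basis[of j]])
    fix n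
    show "d j j (p j n) = scalar_op_poly q (\<delta> j) (p j n)"
      using scalar_op_poly_eigen[OF scalar_ops_linear[OF \<delta>] eig] l l_eq[of j n i0] q by simp
  qed (auto intro: scalar_ops_linear scalar_ops_op_poly d \<delta>)
  moreover have "d = (\<lambda>i j. if i = j then d j j else (\<lambda>p. 0))"
    by (intro ext) (simp add: off)
  ultimately have "D = diag_op (\<lambda>j. scalar_op_poly q (\<delta> j))"
    unfolding Dd diag_op_eq_mat_op_of by metis
  then show "D \<in> {diag_op (\<lambda>j. scalar_op_poly q (\<delta> j)) | q. True}"
    by blast
next
  fix D assume "D \<in> {diag_op (\<lambda>j. scalar_op_poly q (\<delta> j)) | q. True}"
  then obtain q where D: "D = diag_op (\<lambda>j. scalar_op_poly q (\<delta> j))"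
    by blast
  have q_ops: "scalar_op_poly q (\<delta> j) \<in> scalar_ops" for j
    by (intro scalar_ops_op_poly \<delta>)
  have q_eig: "scalar_op_poly q (\<delta> j) (p j n) = smult (poly q (\<mu> n)) (p j n)" for j n
    by (rule scalar_op_poly_eigen[OF scalar_ops_linear[OF \<delta>] eig])
  have "D \<in> mat_D (direct_sum w)"
    unfolding D diag_op_eq_mat_op_of
    by (subst mat_op_of_in_mat_D_iff[OF ops]) (auto simp: q_ops scalar_ops_0 q_eig intro: exI[of _ 0])
  moreover have "op_mult D E = op_mult E D" if E: "E \<in> mat_D (direct_sum w)" for E
  proof -
    obtain d where d: "\<And>i j. d i j \<in> scalar_ops" and Ed: "E = mat_op_of d"
      using E by (auto simp: mat_D_def elim: mat_ops_entries)
    have intertwine: "(\<lambda>x. d i j (scalar_op_poly q (\<delta> i) x)) = (\<lambda>x. scalar_op_poly q (\<delta> j) (d i j x))" for i j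
    proof (rule monic_basis.linear_eqI[OF basis[of i]])
      fix n
      obtain c where c: "d i j (p i n) = smult c (p j n)"
        using E mat_op_of_in_mat_D_iff[of w p d, OF ops d] unfolding Ed by blast
      show "d i j (scalar_op_poly q (\<delta> i) (p i n)) = scalar_op_poly q (\<delta> j) (d i j (p i n))"
        by (simp add: q_eig c module_hom.scale[OF scalar_ops_linear[OF d]]
            module_hom.scale[OF scalar_ops_linear[OF q_ops]] mult.commute)
    qed (intro scalar_ops_linear scalar_ops_comp[OF q_ops d] scalar_ops_comp[OF d q_ops])+
    show ?thesis
    proof (intro ext vec_eq_iff[THEN iffD2] allI)
      fix P a j
      show "op_mult D E P $ a $ j = op_mult E D P $ a $ j"
        using fun_cong[OF intertwine]
        by (simp add: op_mult_def D Ed diag_op_def mat_op_of_def module_hom.sum[OF scalar_ops_linear[OF q_ops]])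
    qed
  qed
  ultimately show "D \<in> mat_Z (direct_sum w)"
    by (simp add: mat_Z_def)
qed

text \<open>The operator determines the values of \<open>q\<close> at the infinitely many eigenvalues of \<open>\<delta>\<close>.\<close>
lemma inj_scalar_op_poly:
  assumes basis: "monic_basis p" and \<delta>: "\<delta> \<in> scalar_ops"
    and eig: "\<And>n. \<delta> (p n) = smult (\<mu> n) (p n)" and inj: "inj \<mu>"
  shows "inj (\<lambda>q. scalar_op_poly q \<delta>)"
proof (rule injI, rule ccontr)
  fix q r assume eq: "scalar_op_poly q \<delta> = scalar_op_poly r \<delta>" and "q \<noteq> r"
  have "poly q (\<mu> n) = poly r (\<mu> n)" for n
  proof -
    have "smult (poly q (\<mu> n)) (p n) = smult (poly r (\<mu> n)) (p n)"
      using fun_cong[OF eq, of "p n"] by (simp add: scalar_op_poly_eigen[OF scalar_ops_linear[OF \<delta>] eig])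
    then show ?thesis
      using monic_basis.p_nonzero[OF basis, of n] by (simp add: smult_cancel_poly)
  qed
  then have "range \<mu> \<subseteq> {x. poly (q - r) x = 0}"
    by auto
  moreover have "finite {x. poly (q - r) x = 0}"
    using \<open>q \<noteq> r\<close> by (intro poly_roots_finite) simp
  ultimately show False
    using range_inj_infinite[OF inj] finite_subset by blast
qed

theorem theorem6p4:
  fixes w :: "'n::finite \<Rightarrow> real \<Rightarrow> real"
    and \<delta> :: "'n \<Rightarrow> complex poly \<Rightarrow> complex poly"
  assumes "\<And>j. classical (w j) (\<delta> j)"
    and "\<And>i j. darboux (w i) (w j)"
  shows "inj (\<lambda>p. mat_op_poly p (diag_op \<delta>)) \<and>
    mat_Z (direct_sum w) = {mat_op_poly p (diag_op \<delta>) | p. True} \<and>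
    mat_Z (direct_sum w) = {diag_op (\<lambda>j. scalar_op_poly p (\<delta> j)) | p. True}"
proof -
  fix k :: 'n
  note cl = assms(1) and db = assms(2)
  define \<mu> where "\<mu> = eigenvalue (\<delta> k)"
  have \<mu>: "eigenvalue (\<delta> j) = \<mu>" for j
    unfolding \<mu>_def by (rule darboux_eigenvalue_eq[OF cl cl db])
  obtain \<sigma> \<tau> where "\<And>j. pearson_weight (w j) (\<sigma> j) (\<tau> j)"
    using classical_pearson_weight[OF cl] by metis
  from mat_monic_ops_direct_sum[OF this]
  have center: "mat_Z (direct_sum w) = {diag_op (\<lambda>j. scalar_op_poly p (\<delta> j)) | p. True}"
  proof (rule center_of_intertwined_family)
    fix i j
    show "monic_basis (scalar_monic_ops (w j))"
      by (rule classical_monic_basis[OF cl])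
    show "\<delta> j \<in> scalar_ops"
      by (rule classical_scalar_ops[OF cl])
    show "\<delta> j (scalar_monic_ops (w j) n) = smult (\<mu> n) (scalar_monic_ops (w j) n)" for n
      using classical_eigen[OF cl, of j n] by (simp only: \<mu>)
    show "\<exists>V\<in>scalar_ops. \<exists>a. \<forall>n. a n \<noteq> 0 \<and> V (scalar_monic_ops (w i) n) = smult (a n) (scalar_monic_ops (w j) n)"
      using darboux_intertwiner[OF db classical_monic_basis[OF cl]] by metis
    show "\<exists>q. \<forall>n. l n = poly q (\<mu> n)"
      if "D \<in> scalar_ops" "\<And>n. D (scalar_monic_ops (w j) n) = smult (l n) (scalar_monic_ops (w j) n)" for D l
      using eigenvalue_is_polynomial_in_classical_eigenvalue[OF cl that] by (simp only: \<mu>)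
  qed
  have "inj (\<lambda>p. mat_op_poly p (diag_op \<delta>))"
  proof (rule injI)
    fix p q assume "mat_op_poly p (diag_op \<delta>) = mat_op_poly q (diag_op \<delta>)"
    then have "scalar_op_poly p (\<delta> k) = scalar_op_poly q (\<delta> k)"
      using diag_op_inject unfolding mat_op_poly_diag_op by metis
    then show "p = q"
      using inj_scalar_op_poly[OF classical_monic_basis[OF cl] classical_scalar_ops[OF cl]
          classical_eigen[OF cl] classical_inj_eigenvalue[OF cl], of k]
      by (rule injD[rotated])
  qed
  with center show ?thesis
    by (simp add: mat_op_poly_diag_op)
qed

end
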